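(* For all integers $n,k$ (with $k$ possibly depending on $n$) and every real $p\in[0,1]$, if $\mathbf{G}\sim\mathcal{G}(n,p,k)$, then asymptotically almost surely every randomized communication protocol solving the search problem $S_{\mathbf{G}}$ has cost $$\Omega\left(\min\left(\frac{1}{\sqrt{n^{0.05}(1-p)}},\ \frac{n^{0.225}}{\log(kn)}\right)\right).$$
   Context: Graphs are over $k$ blocks $V_1\sqcup\dots\sqcup V_k$, $|V_i|=n$, $n$ a power of $2$ with $\log n$ even; $\mathcal{G}(n,p,k)$: each pair of vertices in different blocks is an edge independently with probability $p$, no edges inside blocks. Let $\Sigma=\{0,1\}^{(\log n)/2}$ and identify each vertex of $V_i$ with a pair $(x_i,y_i)\in\Sigma\times\Sigma$ (the two halves of its binary representation). In the search problem $S_G$, Alice receives $x\in\Sigma^k$ and Bob receives $y\in\Sigma^k$; together they select the vertex $(x_i,y_i)$ in each block $V_i$, and they must output a pair of selected vertices (from different blocks) that are not adjacent in $G$. A randomized (public-coin) protocol is a distribution over deterministic two-party protocols that, on every input, outputs a correct answer with probability at least a fixed constant (e.g. $2/3$); its cost is the maximum number of bits communicated by a deterministic protocol in its support. "Asymptotically almost surely": with probability $1-o(1)$ as $n\to\infty$. *)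

theory Defs
  imports "HOL-Probability.Probability"
begin

text \<open>A vertex of block i with coordinates (a,b) is the triple (i,a,b).
  For n = 4^t, the alphabet Sigma = {0,1}^t is identified with {0..<2^t}.\<close>
type_synonym vertex = "nat \<times> nat \<times> nat"

datatype ('a, 'b, 'o) protocol =
    Output 'o
  | AliceSends "'a \<Rightarrow> bool" "('a, 'b, 'o) protocol" "('a, 'b, 'o) protocol"
  | BobSends "'b \<Rightarrow> bool" "('a, 'b, 'o) protocol" "('a, 'b, 'o) protocol"

fun run_protocol :: "('a, 'b, 'o) protocol \<Rightarrow> 'a \<Rightarrow> 'b \<Rightarrow> 'o" where
  "run_protocol (Output r) x y = r"
| "run_protocol (AliceSends f l r) x y =
     (if f x then run_protocol r x y else run_protocol l x y)"
| "run_protocol (BobSends g l r) x y =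
     (if g y then run_protocol r x y else run_protocol l x y)"

fun protocol_cost :: "('a, 'b, 'o) protocol \<Rightarrow> nat" where
  "protocol_cost (Output r) = 0"
| "protocol_cost (AliceSends f l r) = Suc (max (protocol_cost l) (protocol_cost r))"
| "protocol_cost (BobSends g l r) = Suc (max (protocol_cost l) (protocol_cost r))"

text \<open>Size of the alphabet Sigma = {0,1}^((log n)/2), i.e. sqrt n.\<close>
definition sigma_size :: "nat \<Rightarrow> nat" where
  "sigma_size n = nat \<lfloor>sqrt (real n)\<rfloor>"

definition vertices :: "nat \<Rightarrow> nat \<Rightarrow> vertex set" where
  "vertices n k = {(i, a, b). i < k \<and> a < sigma_size n \<and> b < sigma_size n}"

definition potential_edges :: "nat \<Rightarrow> nat \<Rightarrow> vertex set set" where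
  "potential_edges n k =
     {{u, v} | u v. u \<in> vertices n k \<and> v \<in> vertices n k \<and> fst u \<noteq> fst v}"

definition random_graph :: "nat \<Rightarrow> nat \<Rightarrow> real \<Rightarrow> (vertex set \<Rightarrow> bool) pmf" where
  "random_graph n k p = Pi_pmf (potential_edges n k) False (\<lambda>_. bernoulli_pmf p)"

definition valid_input :: "nat \<Rightarrow> nat \<Rightarrow> (nat \<Rightarrow> nat) \<Rightarrow> bool" where
  "valid_input n k x \<longleftrightarrow> (\<forall>i<k. x i < sigma_size n)"

definition search_solution ::
  "nat \<Rightarrow> (vertex set \<Rightarrow> bool) \<Rightarrow> (nat \<Rightarrow> nat) \<Rightarrow> (nat \<Rightarrow> nat) \<Rightarrow> vertex \<times> vertex \<Rightarrow> bool" where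
  "search_solution k G x y uv \<longleftrightarrow>
     (\<exists>i j. i < k \<and> j < k \<and> i \<noteq> j \<and>
        fst uv = (i, x i, y i) \<and> snd uv = (j, x j, y j) \<and> \<not> G {fst uv, snd uv})"

type_synonym det_protocol = "(nat \<Rightarrow> nat, nat \<Rightarrow> nat, vertex \<times> vertex) protocol"

text \<open>A randomized public-coin protocol (distribution over deterministic
  protocols) solves S_G if on every input it is correct with probability
  at least 2/3.\<close>
definition solves_search ::
  "nat \<Rightarrow> nat \<Rightarrow> (vertex set \<Rightarrow> bool) \<Rightarrow> det_protocol pmf \<Rightarrow> bool" where
  "solves_search n k G R \<longleftrightarrow>
     (\<forall>x y. valid_input n k x \<and> valid_input n k y \<longrightarrow>
        measure_pmf.prob R {P. search_solution k G x y (run_protocol P x y)} \<ge> 2/3)"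

text \<open>The lower-bound function min(1/sqrt(n^0.05 (1-p)), n^0.225/log(kn)),
  with the first term read as +infinity when p = 1.\<close>
definition lower_bound :: "nat \<Rightarrow> nat \<Rightarrow> real \<Rightarrow> real" where
  "lower_bound n k p =
     (if p = 1 then real n powr 0.225 / log 2 (real k * real n)
      else min (1 / sqrt (real n powr 0.05 * (1 - p)))
               (real n powr 0.225 / log 2 (real k * real n)))"

end

theory Submission
  imports Defs
begin

text \<open>
  Write N for the alphabet size (the square root of n) and call a set of inputs of one player dense
  on a set F of blocks if fixing the coordinates in any S \<open>\<subseteq>\<close> F leaves at most an
  \<open>N powr (- \<delta> * card S)\<close> fraction of it; here \<open>\<delta> = 19/20\<close>.
  Follow a protocol on uniform inputs through rectangles X \<open>\<times>\<close> Y whose sides are dense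
  on a common set F of free blocks, and in which both players' symbols on all other blocks are fixed
  and the vertices selected there form a clique. A message may destroy the density of its sender's
  side. Density is restored by splitting off a slice that fixes a maximal set S of over-represented
  coordinates, whereupon the other player reveals their symbols in S. That player's side was still
  dense, and by a Chernoff bound every vertex has few non-neighbours among the N candidates
  for a newly revealed vertex, so a non-edge between fixed vertices rarely appears.
  Every fixed block lowers the entropy deficit of the sender by
  \<open>(1 - \<delta>) * ln N\<close>, while a bit and the following restoration raise the
  expected deficit by at most 2; hence a cheap protocol fixes few blocks. At a leaf, an answer using
  a free block is correct with probability at most \<open>N powr - \<delta>\<close>, and an answer
  using two fixed blocks is wrong. Yao's principle transfers this to randomized protocols.
\<close>

subsection \<open>Partitions and rectangles\<close>

lemma real_card_UN_le:
  assumes "finite I" "finite B" "B \<subseteq> (\<Union>i\<in>I. A i)" "\<And>i. i \<in> I \<Longrightarrow> A i \<subseteq> B"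
    "\<And>i. i \<in> I \<Longrightarrow> real (card (A i)) \<le> c"
  shows "real (card B) \<le> real (card I) * c"
proof -
  have "B = (\<Union>i\<in>I. A i)" using assms(3,4) by blast
  then have "card B \<le> (\<Sum>i\<in>I. card (A i))" using card_UN_le[OF assms(1)] by metis
  then have "real (card B) \<le> real (\<Sum>i\<in>I. card (A i))" by (rule of_nat_mono)
  also have "\<dots> = (\<Sum>i\<in>I. real (card (A i)))" by simp
  also have "\<dots> \<le> (\<Sum>i\<in>I. c)" by (intro sum_mono assms(5))
  finally show ?thesis by simp
qed

text \<open>The function \<open>x * ln x\<close> is convex and the left side is its tangent at
  \<open>x = s / m\<close>. Summed over at most \<open>m\<close> classes of total size
  \<open>s\<close>, this bounds the entropy of the class by \<open>ln m\<close>.\<close>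

lemma weighted_ln_ge:
  fixes s m x :: real
  assumes "0 < s" "0 < m" "0 \<le> x"
  shows "x * (ln s - ln m) + x - s / m \<le> x * ln x"
proof (cases "x = 0")
  case True
  then show ?thesis using assms by simp
next
  case False
  then have x: "0 < x" using assms by simp
  have "ln (s / (m * x)) \<le> s / (m * x) - 1"
    using x assms by (intro ln_le_minus_one) simp
  moreover have "ln (s / (m * x)) = ln s - ln m - ln x"
    using x assms by (simp add: ln_div ln_mult)
  ultimately have "x * (ln s - ln m - ln x) \<le> x * (s / (m * x) - 1)"
    using x by (intro mult_left_mono) auto
  also have "\<dots> = s / m - x"
    using x assms by (simp add: field_simps)
  finally show ?thesis by (simp add: algebra_simps)
qed

text \<open>Learning the class of a uniform element of \<open>X\<close> costs at most
  \<open>ln m\<close> of entropy; \<open>d\<close> is the entropy of a full cube on the free blocks.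
  Used for a bit (\<open>m = 2\<close>) and for revealed symbols
  (\<open>m = N ^ card S\<close>).\<close>

lemma sum_class_deficit_le:
  fixes d :: real and m :: nat
  assumes "finite X" "g ` X \<subseteq> C" "finite C" "card C \<le> m"
  shows "(\<Sum>c\<in>C. real (card {x\<in>X. g x = c}) * (d - ln (real (card {x\<in>X. g x = c}))))
           \<le> real (card X) * (d + ln (real m) - ln (real (card X)))"
proof (cases "X = {}")
  case True
  then show ?thesis by simp
next
  case False
  let ?n = "\<lambda>c. real (card {x\<in>X. g x = c})"
  let ?s = "real (card X)"
  have s: "0 < ?s" using False assms by (simp add: card_gt_0_iff)
  have "C \<noteq> {}" using False assms by auto
  then have m: "0 < real m" using assms by (metis card_gt_0_iff of_nat_0_less_iff order_less_le_trans)
  have tot: "(\<Sum>c\<in>C. ?n c) = ?s"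
    using sum.group[OF assms(1,3,2), of "\<lambda>_. 1::real"] by simp
  have "?s * (ln ?s - ln m) + ?s - real (card C) * (?s / m)
      = (\<Sum>c\<in>C. ?n c * (ln ?s - ln m) + ?n c - ?s / m)"
    by (simp add: sum.distrib sum_subtractf tot flip: sum_distrib_right)
  also have "\<dots> \<le> (\<Sum>c\<in>C. ?n c * ln (?n c))"
    using s m by (intro sum_mono weighted_ln_ge) auto
  finally have 1: "?s * (ln ?s - ln m) + ?s - real (card C) * (?s / m) \<le> (\<Sum>c\<in>C. ?n c * ln (?n c))" .
  have "real (card C) * (?s / m) \<le> real m * (?s / m)"
    using assms s by (intro mult_right_mono) auto
  then have 2: "real (card C) * (?s / m) \<le> ?s" using m by simp
  have "(\<Sum>c\<in>C. ?n c * (d - ln (?n c))) = ?s * d - (\<Sum>c\<in>C. ?n c * ln (?n c))"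
    by (simp add: right_diff_distrib sum_subtractf tot flip: sum_distrib_right)
  also have "\<dots> \<le> ?s * d - ?s * (ln ?s - ln m)" using 1 2 by linarith
  finally show ?thesis by (simp add: algebra_simps)
qed

section \<open>Conflicts between vertices, and counting in rectangles\<close>

type_synonym conflict = "nat \<Rightarrow> nat \<Rightarrow> nat \<Rightarrow> nat \<Rightarrow> nat \<Rightarrow> nat \<Rightarrow> bool"

text \<open>Exchanges the two halves of every vertex, hence the roles of the players; arguments
  about a message from Alice are reused for Bob through it.\<close>

definition transpose_conflict :: "conflict \<Rightarrow> conflict" where
  "transpose_conflict Q = (\<lambda>i b a j b' a'. Q i a b j a' b')"

lemma transpose_conflict_involutive : "transpose_conflict (transpose_conflict Q) = Q"
  by (simp add: transpose_conflict_def)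

definition input_cube :: "nat \<Rightarrow> nat \<Rightarrow> (nat \<Rightarrow> nat) set" where
  "input_cube k N = (\<Pi>\<^sub>E i\<in>{..<k}. {..<N})"

text \<open>The only property of the random graph that the lower bound uses. When a block is
  revealed, one player's symbol there is already fixed, so the candidate vertices form a row or a
  column of the block. Pairs inside one block are exempt, since they are never edges.\<close>

definition few_conflicts :: "nat \<Rightarrow> nat \<Rightarrow> real \<Rightarrow> conflict \<Rightarrow> bool" where
  "few_conflicts k N \<Delta> Q \<longleftrightarrow> (\<forall>i a b j a' b'. Q i a b j a' b' \<longrightarrow> Q j a' b' i a b) \<and>
     (\<forall>i<k. \<forall>j<k. i \<noteq> j \<longrightarrow> (\<forall>a<N. \<forall>a'<N. \<forall>b'<N. real (card {b. b < N \<and> Q i a b j a' b'}) \<le> \<Delta>)) \<and>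
     (\<forall>i<k. \<forall>j<k. i \<noteq> j \<longrightarrow> (\<forall>b<N. \<forall>a'<N. \<forall>b'<N. real (card {a. a < N \<and> Q i a b j a' b'}) \<le> \<Delta>))"

lemma few_conflicts_sym: "few_conflicts k N \<Delta> Q \<Longrightarrow> Q i a b j a' b' \<Longrightarrow> Q j a' b' i a b"
  unfolding few_conflicts_def by (drule conjunct1) iprover

lemma few_conflicts_right:
  assumes "few_conflicts k N \<Delta> Q" "i < k" "j < k" "i \<noteq> j" "a < N" "a' < N" "b' < N"
  shows "real (card {b. b < N \<and> Q i a b j a' b'}) \<le> \<Delta>"
  using conjunct1[OF conjunct2[OF assms(1)[unfolded few_conflicts_def]]] assms(2-) by blast

lemma few_conflicts_left:
  assumes "few_conflicts k N \<Delta> Q" "i < k" "j < k" "i \<noteq> j" "b < N" "a' < N" "b' < N"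
  shows "real (card {a. a < N \<and> Q i a b j a' b'}) \<le> \<Delta>"
  using conjunct2[OF conjunct2[OF assms(1)[unfolded few_conflicts_def]]] assms(2-) by blast

lemma few_conflicts_transpose:
  assumes "few_conflicts k N \<Delta> Q"
  shows "few_conflicts k N \<Delta> (transpose_conflict Q)"
  unfolding few_conflicts_def transpose_conflict_def
  by (intro conjI allI impI few_conflicts_left[OF assms] few_conflicts_right[OF assms])
    (rule few_conflicts_sym[OF assms])

text \<open>Success probability on uniform inputs, left unnormalised: counts add over a partition,
  and empty rectangles need no conditioning.\<close>

definition hits :: "('a \<Rightarrow> 'b \<Rightarrow> bool) \<Rightarrow> 'a set \<Rightarrow> 'b set \<Rightarrow> real" where
  "hits W X Y = (\<Sum>x\<in>X. \<Sum>y\<in>Y. of_bool (W x y))"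

lemma hits_transpose: "hits (\<lambda>y x. W x y) Y X = hits W X Y"
  unfolding hits_def by (rule sum.swap)

lemma hits_le: "hits W X Y \<le> real (card X) * real (card Y)"
proof -
  have "hits W X Y \<le> (\<Sum>x\<in>X. \<Sum>y\<in>Y. 1)"
    unfolding hits_def by (intro sum_mono) simp
  then show ?thesis by simp
qed

lemma hits_group_left:
  assumes "finite X" "g ` X \<subseteq> C" "finite C"
  shows "hits W X Y = (\<Sum>c\<in>C. hits W {x\<in>X. g x = c} Y)"
  unfolding hits_def by (rule sum.group[OF assms(1,3,2), symmetric])

lemma hits_group_right:
  assumes "finite Y" "g ` Y \<subseteq> C" "finite C"
  shows "hits W X Y = (\<Sum>c\<in>C. hits W X {y\<in>Y. g y = c})"
  using hits_group_left[OF assms, of "\<lambda>y x. W x y"] hits_transpose[of W] by simp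

definition slice :: "(nat \<Rightarrow> nat) set \<Rightarrow> nat set \<Rightarrow> (nat \<Rightarrow> nat) \<Rightarrow> (nat \<Rightarrow> nat) set" where
  "slice X S \<alpha> = {x\<in>X. \<forall>i\<in>S. x i = \<alpha> i}"

subsection \<open>Dense rectangles\<close>

text \<open>\<open>\<kappa>\<close> is the price of one nat of deficit. Exceeding M fixed blocks counts as a
  success of the protocol, so each fixed block is charged 1/M. The assumption \<open>gain\<close> says that the
  deficit released by fixing a block pays for this charge, for the risk of a non-edge and for one
  restoration step.\<close>

locale density_walk =
  fixes k N :: nat and \<delta> M \<Delta> \<kappa> :: real
  assumes N_ge: "2 \<le> N" and \<delta>_le: "\<delta> \<le> 1" and M_pos: "0 < M"
    and \<Delta>_nonneg: "0 \<le> \<Delta>" and \<kappa>_nonneg: "0 \<le> \<kappa>"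
    and gain: "1 / M + M * \<Delta> * real N powr (1 - 2 * \<delta>) \<le> \<kappa> * ((1 - \<delta>) * ln (real N) - 1)"
begin

abbreviation cube :: "(nat \<Rightarrow> nat) set" where
  "cube \<equiv> input_cube k N"

definition settled :: "nat set \<Rightarrow> (nat \<Rightarrow> nat) set \<Rightarrow> bool" where
  "settled F X \<longleftrightarrow> (\<forall>i\<in>{..<k} - F. \<forall>x\<in>X. \<forall>x'\<in>X. x i = x' i)"

text \<open>Blockwise min-entropy rate \<delta>, as in lifting theorems. The inequality is
  multiplied out, so the empty set is dense.\<close>

definition dense :: "nat set \<Rightarrow> (nat \<Rightarrow> nat) set \<Rightarrow> bool" where
  "dense F X \<longleftrightarrow> (\<forall>S\<subseteq>F. \<forall>\<alpha>. real (card (slice X S \<alpha>)) * real N powr (\<delta> * real (card S)) \<le> real (card X))"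

text \<open>Entropy missing from the uniform distribution on \<open>X\<close>, compared with all
  inputs on the free blocks. For empty \<open>X\<close> the convention \<open>ln 0 = 0\<close> does
  no harm, because deficits are weighted by \<open>card X\<close>.\<close>

definition deficit :: "nat set \<Rightarrow> (nat \<Rightarrow> nat) set \<Rightarrow> real" where
  "deficit F X = real (card F) * ln (real N) - ln (real (card X))"

definition clean :: "conflict \<Rightarrow> nat set \<Rightarrow> (nat \<Rightarrow> nat) set \<Rightarrow> (nat \<Rightarrow> nat) set \<Rightarrow> bool" where
  "clean Q F X Y \<longleftrightarrow> (\<forall>i\<in>{..<k} - F. \<forall>j\<in>{..<k} - F. i \<noteq> j \<longrightarrow>
     (\<forall>x\<in>X. \<forall>y\<in>Y. \<not> Q i (x i) (y i) j (x j) (y j)))"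

definition state :: "conflict \<Rightarrow> nat set \<Rightarrow> (nat \<Rightarrow> nat) set \<Rightarrow> (nat \<Rightarrow> nat) set \<Rightarrow> bool" where
  "state Q F X Y \<longleftrightarrow> F \<subseteq> {..<k} \<and> X \<subseteq> cube \<and> Y \<subseteq> cube \<and> settled F X \<and> settled F Y \<and> clean Q F X Y"

text \<open>Upper bound for the success probability on a rectangle: \<open>A\<close> is the value at
  the full cube, and the other terms measure how far the rectangle has moved away from it.\<close>

definition potential :: "real \<Rightarrow> nat set \<Rightarrow> (nat \<Rightarrow> nat) set \<Rightarrow> (nat \<Rightarrow> nat) set \<Rightarrow> real" where
  "potential A F X Y = A + real (card ({..<k} - F)) / M + \<kappa> * (deficit F X + deficit F Y)"

definition dense_bound :: "conflict \<Rightarrow> ((nat \<Rightarrow> nat) \<Rightarrow> (nat \<Rightarrow> nat) \<Rightarrow> bool) \<Rightarrow> real \<Rightarrow> bool" where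
  "dense_bound Q W A \<longleftrightarrow> (\<forall>F X Y. state Q F X Y \<longrightarrow> dense F X \<longrightarrow> dense F Y \<longrightarrow>
     hits W X Y \<le> real (card X) * real (card Y) * potential A F X Y)"

text \<open>The sender's side \<open>X\<close> may have lost its density through a message; the
  surcharge \<kappa> pays for restoring it.\<close>

definition half_dense_bound ::
  "conflict \<Rightarrow> ((nat \<Rightarrow> nat) \<Rightarrow> (nat \<Rightarrow> nat) \<Rightarrow> bool) \<Rightarrow> real \<Rightarrow> nat set \<Rightarrow> bool" where
  "half_dense_bound Q W A F \<longleftrightarrow> (\<forall>X Y. state Q F X Y \<longrightarrow> dense F Y \<longrightarrow>
     hits W X Y \<le> real (card X) * real (card Y) * (potential A F X Y + \<kappa>))"

lemma finite_cube: "finite cube"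
  unfolding input_cube_def by (intro finite_PiE) auto

lemma finite_subset_cube: "X \<subseteq> cube \<Longrightarrow> finite X"
  using finite_cube finite_subset by blast

lemma cube_less: "x \<in> cube \<Longrightarrow> i < k \<Longrightarrow> x i < N"
  unfolding input_cube_def by (auto simp: PiE_iff)

lemma settled_mono: "settled F X \<Longrightarrow> X' \<subseteq> X \<Longrightarrow> settled F X'"
  unfolding settled_def by blast

lemma clean_mono: "clean Q F X Y \<Longrightarrow> X' \<subseteq> X \<Longrightarrow> Y' \<subseteq> Y \<Longrightarrow> clean Q F X' Y'"
  unfolding clean_def by blast

lemma state_mono:
  assumes "state Q F X Y" "X' \<subseteq> X" "Y' \<subseteq> Y"
  shows "state Q F X' Y'"
  using assms settled_mono[of F X X'] settled_mono[of F Y Y'] clean_mono[of Q F X Y X' Y']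
  unfolding state_def by auto

lemma state_transpose: "state (transpose_conflict Q) F Y X \<longleftrightarrow> state Q F X Y"
  unfolding state_def clean_def transpose_conflict_def by auto

lemma dense_bound_transpose:
  assumes "dense_bound Q W A"
  shows "dense_bound (transpose_conflict Q) (\<lambda>y x. W x y) A"
  unfolding dense_bound_def
proof (intro allI impI)
  fix F Y X assume "state (transpose_conflict Q) F Y X" "dense F Y" "dense F X"
  then show "hits (\<lambda>y x. W x y) Y X \<le> real (card Y) * real (card X) * potential A F Y X"
    using assms unfolding dense_bound_def
    by (simp add: state_transpose hits_transpose[of W Y X] potential_def add.commute mult.commute)
qed

text \<open>An element of a settled set is determined by its free coordinates, which leaves at most
  \<open>N ^ card F\<close> elements.\<close>

lemma deficit_nonneg:
  assumes "F \<subseteq> {..<k}" "X \<subseteq> cube" "X \<noteq> {}" "settled F X"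
  shows "0 \<le> deficit F X"
proof -
  have finF: "finite F" using assms(1) finite_subset by blast
  have inj: "inj_on (\<lambda>x. restrict x F) X"
  proof (rule inj_onI)
    fix x x' assume x: "x \<in> X" "x' \<in> X" and eq: "restrict x F = restrict x' F"
    show "x = x'"
    proof
      fix i
      consider "i \<in> F" | "i \<in> {..<k} - F" | "i \<notin> {..<k}" by blast
      then show "x i = x' i"
      proof cases
        case 1
        then show ?thesis using eq by (metis restrict_apply)
      next
        case 2
        then show ?thesis using assms(4) x unfolding settled_def by blast
      next
        case 3
        then show ?thesis using assms(2) x unfolding input_cube_def by (metis PiE_arb subsetD)
      qed
    qed
  qed
  have sub: "(\<lambda>x. restrict x F) ` X \<subseteq> (\<Pi>\<^sub>E i\<in>F. {..<N})"
  proof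
    fix z assume "z \<in> (\<lambda>x. restrict x F) ` X"
    then obtain x where "x \<in> X" "z = restrict x F" by blast
    moreover from this have "x i < N" if "i \<in> F" for i
      using assms(1,2) that by (intro cube_less) auto
    ultimately show "z \<in> (\<Pi>\<^sub>E i\<in>F. {..<N})" by auto
  qed
  have "card X \<le> card (\<Pi>\<^sub>E i\<in>F. {..<N})"
    using card_inj_on_le[OF inj sub] finF by (simp add: finite_PiE)
  also have "\<dots> = N ^ card F" using finF by (simp add: card_PiE)
  finally have "real (card X) \<le> real N ^ card F" by (metis of_nat_le_iff of_nat_power)
  moreover have "0 < real (card X)"
    using assms(2,3) finite_subset_cube by (simp add: card_gt_0_iff)
  ultimately have "ln (real (card X)) \<le> ln (real N ^ card F)"
    using N_ge by (intro ln_mono) auto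
  then show ?thesis using N_ge unfolding deficit_def by (simp add: ln_realpow)
qed

section \<open>Conflicts met by a dense side\<close>

lemma card_pattern_le:
  assumes "dense F Y" "S \<subseteq> F"
  shows "real (card (slice Y S \<beta>)) \<le> real (card Y) * real N powr (- \<delta> * real (card S))"
proof -
  have "real (card (slice Y S \<beta>)) * real N powr (\<delta> * real (card S)) \<le> real (card Y)"
    using assms unfolding dense_def by blast
  then have "real (card (slice Y S \<beta>)) * real N powr (\<delta> * real (card S)) * real N powr (- \<delta> * real (card S))
     \<le> real (card Y) * real N powr (- \<delta> * real (card S))"
    by (rule mult_right_mono) simp
  then show ?thesis using N_ge by (simp add: mult.assoc flip: powr_add)
qed

lemma card_coordinate_le:
  assumes "dense F Y" "i \<in> F"
  shows "real (card {y\<in>Y. y i = b}) \<le> real (card Y) * real N powr (- \<delta>)"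
  using card_pattern_le[OF assms(1), of "{i}" "\<lambda>_. b"] assms(2) by (simp add: slice_def)

lemma card_two_coordinates_le:
  assumes "dense F Y" "i \<in> F" "j \<in> F" "i \<noteq> j"
  shows "real (card {y\<in>Y. y i = b \<and> y j = b'}) \<le> real (card Y) * real N powr (- 2 * \<delta>)"
  using card_pattern_le[OF assms(1), of "{i,j}" "(\<lambda>_. b)(j := b')"] assms(2-)
  by (simp add: slice_def mult.commute)

text \<open>Once \<open>y j\<close> is fixed, at most \<Delta> symbols \<open>y i\<close> conflict,
  and density bounds the share of each. If \<open>j\<close> is free, a pair of symbols has share at
  most \<open>N powr (- 2 * \<delta>)\<close> and \<open>y j\<close> has \<open>N\<close> values; if
  \<open>j\<close> is not free, only one value of \<open>y j\<close> occurs.\<close>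

lemma card_conflict_le:
  assumes Q: "few_conflicts k N \<Delta> Q" and st: "state Q F X Y" and dY: "dense F Y"
    and i: "i \<in> F" and j: "j < k" "i \<noteq> j" and a: "a < N" "a' < N"
  shows "real (card {y\<in>Y. Q i a (y i) j a' (y j)}) \<le> real (card Y) * (\<Delta> * real N powr (1 - 2 * \<delta>))"
proof -
  have Y: "Y \<subseteq> cube" and sY: "settled F Y" and F: "F \<subseteq> {..<k}"
    using st unfolding state_def by auto
  have finY: "finite Y" using Y by (rule finite_subset_cube)
  have Y_less: "y h < N" if "y \<in> Y" "h < k" for y h
    using cube_less[of y h] Y that by blast
  have ik: "i < k" using i F by auto
  define T where "T b' = {b. b < N \<and> Q i a b j a' b'}" for b'
  have finT: "finite (T b')" for b' unfolding T_def by simp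
  have T: "real (card (T b')) \<le> \<Delta>" if "b' < N" for b'
    using few_conflicts_right[OF Q ik j a that] unfolding T_def .
  have row: "real (card {y\<in>Y. Q i a (y i) j a' (y j) \<and> y j = b'}) \<le> \<Delta> * B"
    if b': "b' < N" and B: "\<And>b. real (card {y\<in>Y. y i = b \<and> y j = b'}) \<le> B" for b' B
  proof -
    have "0 \<le> B" using B[of 0] by (meson of_nat_0_le_iff order_trans)
    have "{y\<in>Y. Q i a (y i) j a' (y j) \<and> y j = b'} \<subseteq> (\<Union>b\<in>T b'. {y\<in>Y. Q i a (y i) j a' (y j) \<and> y i = b \<and> y j = b'})"
      using Y_less ik unfolding T_def by blast
    moreover have "real (card {y\<in>Y. Q i a (y i) j a' (y j) \<and> y i = b \<and> y j = b'}) \<le> B" for b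
    proof -
      have "card {y\<in>Y. Q i a (y i) j a' (y j) \<and> y i = b \<and> y j = b'} \<le> card {y\<in>Y. y i = b \<and> y j = b'}"
        using finY by (intro card_mono) auto
      then show ?thesis using B[of b] by linarith
    qed
    ultimately have "real (card {y\<in>Y. Q i a (y i) j a' (y j) \<and> y j = b'}) \<le> real (card (T b')) * B"
      using finT finY by (intro real_card_UN_le) auto
    also have "\<dots> \<le> \<Delta> * B" using T[OF b'] \<open>0 \<le> B\<close> by (simp add: mult_right_mono)
    finally show ?thesis .
  qed
  show ?thesis
  proof (cases "j \<in> F")
    case True
    have "real (card {y\<in>Y. Q i a (y i) j a' (y j)})
      \<le> real (card {..<N}) * (\<Delta> * (real (card Y) * real N powr (- 2 * \<delta>)))"
    proof (rule real_card_UN_le)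
      show "{y\<in>Y. Q i a (y i) j a' (y j)} \<subseteq> (\<Union>b'\<in>{..<N}. {y\<in>Y. Q i a (y i) j a' (y j) \<and> y j = b'})"
        using Y_less j by blast
      show "real (card {y\<in>Y. Q i a (y i) j a' (y j) \<and> y j = b'}) \<le> \<Delta> * (real (card Y) * real N powr (- 2 * \<delta>))"
        if "b' \<in> {..<N}" for b'
        using that card_two_coordinates_le[OF dY i True j(2)] by (intro row) auto
    qed (use finY in auto)
    also have "\<dots> = real (card Y) * (\<Delta> * (real N powr 1 * real N powr (- 2 * \<delta>)))"
      using N_ge by simp
    also have "\<dots> = real (card Y) * (\<Delta> * real N powr (1 - 2 * \<delta>))"
      by (subst powr_add[symmetric]) simp
    finally show ?thesis .
  next
    case False
    show ?thesis
    proof (cases "Y = {}")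
      case True
      then show ?thesis by simp
    next
      case nonempty: False
      then obtain y0 where y0: "y0 \<in> Y" by blast
      then have const: "\<And>y. y \<in> Y \<Longrightarrow> y j = y0 j"
        using sY False j unfolding settled_def by blast
      have "y0 j < N" using y0 Y j cube_less by blast
      have "{y\<in>Y. Q i a (y i) j a' (y j)} = {y\<in>Y. Q i a (y i) j a' (y j) \<and> y j = y0 j}"
        using const by auto
      moreover have "real (card {y\<in>Y. Q i a (y i) j a' (y j) \<and> y j = y0 j})
          \<le> \<Delta> * (real (card Y) * real N powr (- \<delta>))"
      proof (rule row[OF \<open>y0 j < N\<close>])
        fix b
        have "card {y\<in>Y. y i = b \<and> y j = y0 j} \<le> card {y\<in>Y. y i = b}"
          using finY by (intro card_mono) auto
        then show "real (card {y\<in>Y. y i = b \<and> y j = y0 j}) \<le> real (card Y) * real N powr (- \<delta>)"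
          using card_coordinate_le[OF dY i, of b] by linarith
      qed
      \<comment> \<open>From \<delta> \<le> 1, the bound for fixed \<open>j\<close> is no larger
        than the one for free \<open>j\<close>.\<close>
      moreover have "real N powr (- \<delta>) \<le> real N powr (1 - 2 * \<delta>)"
        using N_ge \<delta>_le by (intro powr_mono) auto
      then have "\<Delta> * (real (card Y) * real N powr (- \<delta>)) \<le> \<Delta> * (real (card Y) * real N powr (1 - 2 * \<delta>))"
        using \<Delta>_nonneg by (intro mult_left_mono) auto
      ultimately show ?thesis by (simp add: mult_ac)
    qed
  qed
qed

lemma potential_nonneg:
  assumes "state Q F X Y" "X \<noteq> {}" "Y \<noteq> {}" "0 \<le> A"
  shows "0 \<le> potential A F X Y"
  using assms deficit_nonneg[of F X] deficit_nonneg[of F Y] \<kappa>_nonneg M_pos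
  unfolding state_def potential_def by (intro add_nonneg_nonneg mult_nonneg_nonneg divide_nonneg_nonneg) auto

section \<open>Revealing the other player's symbols\<close>

definition reveal_risk :: real where
  "reveal_risk = M * \<Delta> * real N powr (1 - 2 * \<delta>)"

lemma reveal_risk_nonneg: "0 \<le> reveal_risk"
  unfolding reveal_risk_def using M_pos \<Delta>_nonneg by simp

text \<open>Revealing \<open>S\<close> gives at most \<open>N ^ card S\<close> classes and so costs
  at most \<open>card S * ln N\<close> of entropy; taking \<open>S\<close> out of the free blocks
  lowers the reference entropy by exactly this amount.\<close>

lemma sum_slices_deficit_le:
  assumes "finite Y" "S \<subseteq> F" "F \<subseteq> {..<k}" "Y \<subseteq> cube"
  shows "(\<Sum>c\<in>(\<lambda>y. restrict y S) ` Y. real (card {y\<in>Y. restrict y S = c}) * deficit (F - S) {y\<in>Y. restrict y S = c})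
    \<le> real (card Y) * deficit F Y"
proof -
  have finF: "finite F" by (rule finite_subset[OF assms(3)]) simp
  then have finS: "finite S" by (rule finite_subset[OF assms(2)])
  have "(\<lambda>y. restrict y S) ` Y \<subseteq> (\<Pi>\<^sub>E i\<in>S. {..<N})"
  proof
    fix z assume "z \<in> (\<lambda>y. restrict y S) ` Y"
    then obtain y where "y \<in> Y" "z = restrict y S" by blast
    moreover from this have "y i < N" if "i \<in> S" for i
      using assms that by (intro cube_less) auto
    ultimately show "z \<in> (\<Pi>\<^sub>E i\<in>S. {..<N})" by auto
  qed
  then have "card ((\<lambda>y. restrict y S) ` Y) \<le> card (\<Pi>\<^sub>E i\<in>S. {..<N})"
    using finS by (intro card_mono finite_PiE) auto
  also have "\<dots> = N ^ card S" using finS by (simp add: card_PiE)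
  finally have m: "card ((\<lambda>y. restrict y S) ` Y) \<le> N ^ card S" .
  have "card (F - S) = card F - card S" "card S \<le> card F"
    using finF finS assms(2) by (auto simp: card_Diff_subset card_mono)
  then have "real (card F) = real (card (F - S)) + real (card S)" by simp
  then have "real (card (F - S)) * ln (real N) + ln (real (N ^ card S)) = real (card F) * ln (real N)"
    using N_ge by (simp add: ln_realpow distrib_right)
  then show ?thesis
    using sum_class_deficit_le[OF assms(1) order_refl finite_imageI[OF assms(1)] m, of "real (card (F - S)) * ln (real N)"]
    unfolding deficit_def by simp
qed

text \<open>\<open>X\<close> has just been fixed on \<open>S\<close> and is dense on
  \<open>F - S\<close>; now \<open>Y\<close> is split by its symbols on \<open>S\<close>. Slices
  that reveal a conflict are conceded to the protocol. On every other slice the players swap roles: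
  the slice may have lost its density while \<open>X\<close> is dense, which is the situation of
  \<open>half\<close>.\<close>

lemma hits_revealed_slice:
  assumes Q: "few_conflicts k N \<Delta> Q" and A: "0 \<le> A"
    and half: "half_dense_bound (transpose_conflict Q) (\<lambda>y x. W x y) A (F - S)"
    and st: "state Q F X Y" and ne: "X \<noteq> {}" and S: "S \<subseteq> F"
    and sX: "settled (F - S) X" and dX: "dense (F - S) X" and dY: "dense F Y"
  shows "hits W X Y \<le> real (card X) * real (card Y) *
    (A + real (card ({..<k} - (F - S))) / M + \<kappa> * (deficit (F - S) X + deficit F Y) + \<kappa> + real (card S) * reveal_risk)"
proof (cases "Y = {}")
  case True
  then show ?thesis by (simp add: hits_def)
next
  case neY: False
  let ?I = "{..<k} - (F - S)"
  have F: "F \<subseteq> {..<k}" and X: "X \<subseteq> cube" and Y: "Y \<subseteq> cube" and sY: "settled F Y" and cl: "clean Q F X Y"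
    using st unfolding state_def by auto
  have finX: "finite X" and finY: "finite Y" using X Y finite_subset_cube by auto
  have defX: "0 \<le> deficit (F - S) X" using F X ne sX by (intro deficit_nonneg) auto
  have defY: "0 \<le> deficit F Y" using F Y neY sY by (intro deficit_nonneg) auto
  \<comment> \<open>With more than \<open>M\<close> fixed blocks the charge
    \<open>card ?I / M\<close> exceeds 1 and the bound is trivial. Otherwise at most
    \<open>card S * M\<close> pairs of blocks enter the union bound below.\<close>
  show ?thesis
  proof (cases "M < real (card ?I)")
    case True
    then have "1 \<le> real (card ?I) / M" using M_pos by simp
    then have "1 \<le> A + real (card ?I) / M + \<kappa> * (deficit (F - S) X + deficit F Y) + \<kappa> + real (card S) * reveal_risk"
      using A defX defY \<kappa>_nonneg reveal_risk_nonneg by (simp add: add_increasing2)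
    then have "real (card X) * real (card Y) * 1 \<le> real (card X) * real (card Y) *
       (A + real (card ?I) / M + \<kappa> * (deficit (F - S) X + deficit F Y) + \<kappa> + real (card S) * reveal_risk)"
      by (intro mult_left_mono) auto
    then show ?thesis using hits_le[of W X Y] by linarith
  next
    case False
    obtain x0 where x0: "x0 \<in> X" using ne by blast
    have const: "x i = x0 i" if "x \<in> X" "i \<in> ?I" for x i
      using sX x0 that unfolding settled_def by blast
    \<comment> \<open>A conflict between a newly revealed block and any other block fixed by now;
      \<open>x0\<close> represents all of \<open>X\<close>, which is constant on
      \<open>?I\<close>.\<close>
    define bad where "bad y \<longleftrightarrow> (\<exists>i\<in>S. \<exists>j\<in>?I - {i}. Q i (x0 i) (y i) j (x0 j) (y j))" for y
    have finS: "finite S" by (rule finite_subset[of _ "{..<k}"]) (use S F in auto)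
    define R where "R ij = {y\<in>Y. Q (fst ij) (x0 (fst ij)) (y (fst ij)) (snd ij) (x0 (snd ij)) (y (snd ij))}" for ij
    have bad_eq: "{y\<in>Y. bad y} = (\<Union>ij\<in>Sigma S (\<lambda>i. ?I - {i}). R ij)"
      unfolding bad_def R_def
      by (intro set_eqI) (simp only: mem_Collect_eq UN_iff split_paired_Bex_Sigma fst_conv snd_conv, simp)
    have "real (card {y\<in>Y. bad y}) \<le> real (card (Sigma S (\<lambda>i. ?I - {i}))) * (real (card Y) * (\<Delta> * real N powr (1 - 2 * \<delta>)))"
    proof (rule real_card_UN_le[OF _ _ eq_refl[OF bad_eq]])
      fix ij assume ij: "ij \<in> Sigma S (\<lambda>i. ?I - {i})"
      then have "fst ij \<in> F" "snd ij < k" "fst ij \<noteq> snd ij" "fst ij < k" using S F by auto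
      then show "real (card (R ij)) \<le> real (card Y) * (\<Delta> * real N powr (1 - 2 * \<delta>))"
        unfolding R_def using x0 X cube_less by (intro card_conflict_le[OF Q st dY]) auto
      show "R ij \<subseteq> {y\<in>Y. bad y}" using ij unfolding bad_eq by blast
    qed (use finS finY in auto)
    also have "\<dots> \<le> (real (card S) * M) * (real (card Y) * (\<Delta> * real N powr (1 - 2 * \<delta>)))"
    proof (intro mult_right_mono)
      have "card (Sigma S (\<lambda>i. ?I - {i})) = (\<Sum>i\<in>S. card (?I - {i}))"
        using finS by (simp add: card_SigmaI)
      also have "\<dots> \<le> (\<Sum>i\<in>S. card ?I)" by (intro sum_mono card_mono) auto
      finally have "card (Sigma S (\<lambda>i. ?I - {i})) \<le> card S * card ?I" by simp
      then have "real (card (Sigma S (\<lambda>i. ?I - {i}))) \<le> real (card S) * real (card ?I)"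
        by (metis of_nat_le_iff of_nat_mult)
      also have "\<dots> \<le> real (card S) * M" using False by (intro mult_left_mono) auto
      finally show "real (card (Sigma S (\<lambda>i. ?I - {i}))) \<le> real (card S) * M" .
    qed (use \<Delta>_nonneg in auto)
    finally have card_bad: "real (card {y\<in>Y. bad y}) \<le> real (card Y) * (real (card S) * reveal_risk)"
      unfolding reveal_risk_def by (simp add: mult_ac)
    define C where "C = (\<lambda>y. restrict y S) ` Y"
    define Z where "Z c = {y\<in>Y. restrict y S = c}" for c
    define B where "B = A + real (card ?I) / M + \<kappa> * deficit (F - S) X + \<kappa>"
    have B: "0 \<le> B" unfolding B_def using A defX \<kappa>_nonneg M_pos by simp
    have finC: "finite C" unfolding C_def using finY by simp
    have piece: "hits W X (Z c) \<le> real (card X) *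
        (B * real (card (Z c)) + \<kappa> * (real (card (Z c)) * deficit (F - S) (Z c)) + real (card {y\<in>Z c. bad y}))"
      if c: "c \<in> C" for c
    proof -
      have neZ: "Z c \<noteq> {}" and ZY: "Z c \<subseteq> Y" using c unfolding C_def Z_def by blast+
      have Zcube: "Z c \<subseteq> cube" using ZY Y by blast
      have agree: "y i = y' i" if "y \<in> Z c" "y' \<in> Z c" "i \<in> ?I" for y y' i
      proof (cases "i \<in> S")
        case True
        then show ?thesis using that unfolding Z_def by (metis (mono_tags, lifting) mem_Collect_eq restrict_apply)
      next
        case False
        then show ?thesis using that sY ZY unfolding settled_def by blast
      qed
      have sZ: "settled (F - S) (Z c)" using agree unfolding settled_def by blast
      have defZ: "0 \<le> deficit (F - S) (Z c)"
        using F Zcube neZ sZ by (intro deficit_nonneg) auto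
      \<comment> \<open>Whether \<open>y\<close> is bad depends only on coordinates in
        \<open>?I\<close>, where the slice is constant; so a slice is bad entirely or not at
        all.\<close>
      show ?thesis
      proof (cases "\<exists>y\<in>Z c. bad y")
        case True
        then obtain y0 where y0: "y0 \<in> Z c" "bad y0" by blast
        have "bad y" if "y \<in> Z c" for y
        proof -
          have "y i = y0 i" if "i \<in> ?I" for i using agree[OF \<open>y \<in> Z c\<close> y0(1) that] .
          moreover have "S \<subseteq> ?I" using S F by blast
          ultimately have "y i = y0 i" "\<And>j. j \<in> ?I - {i} \<Longrightarrow> y j = y0 j" if "i \<in> S" for i
            using that by blast+
          moreover obtain i j where "i \<in> S" "j \<in> ?I - {i}" "Q i (x0 i) (y0 i) j (x0 j) (y0 j)"
            using y0(2) unfolding bad_def by blast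
          ultimately show ?thesis unfolding bad_def by (intro bexI[of _ i] bexI[of _ j]) simp_all
        qed
        then have "{y\<in>Z c. bad y} = Z c" by blast
        then have "hits W X (Z c) \<le> real (card X) * real (card {y\<in>Z c. bad y})"
          using hits_le[of W X "Z c"] by simp
        also have "\<dots> \<le> real (card X) *
          (B * real (card (Z c)) + \<kappa> * (real (card (Z c)) * deficit (F - S) (Z c)) + real (card {y\<in>Z c. bad y}))"
          using B \<kappa>_nonneg defZ by (intro mult_left_mono) auto
        finally show ?thesis .
      next
        case good: False
        have "clean Q (F - S) X (Z c)"
          unfolding clean_def
        proof (intro ballI impI)
          fix i j x y assume ij: "i \<in> ?I" "j \<in> ?I" "i \<noteq> j" and xy: "x \<in> X" "y \<in> Z c"
          have eq: "x i = x0 i" "x j = x0 j" using const ij xy by auto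
          show "\<not> Q i (x i) (y i) j (x j) (y j)"
          proof
            assume q: "Q i (x i) (y i) j (x j) (y j)"
            \<comment> \<open>A conflict touching \<open>S\<close> would make the slice bad, for
              \<open>j \<in> S\<close> after exchanging the two vertices; one between older blocks
              would contradict the cleanliness of the whole rectangle.\<close>
            consider "i \<in> S" | "j \<in> S" | "i \<in> {..<k} - F" "j \<in> {..<k} - F" using ij by blast
            then show False
            proof cases
              case 1
              then show False using good q eq ij xy unfolding bad_def by (metis DiffI singletonD)
            next
              case 2
              then show False using good few_conflicts_sym[OF Q q] eq ij xy unfolding bad_def
                by (metis DiffI singletonD)
            next
              case 3
              then show False using cl q ij(3) xy ZY unfolding clean_def by blast
            qed
          qed
        qed
        then have "state Q (F - S) X (Z c)"
          unfolding state_def using F X Zcube sX sZ by auto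
        then have "hits (\<lambda>y x. W x y) (Z c) X \<le> real (card (Z c)) * real (card X) * (potential A (F - S) (Z c) X + \<kappa>)"
          using half dX unfolding half_dense_bound_def by (simp add: state_transpose)
        then have "hits W X (Z c) \<le> real (card (Z c)) * real (card X) * (potential A (F - S) (Z c) X + \<kappa>)"
          by (simp add: hits_transpose[of W "Z c" X])
        also have "\<dots> = real (card X) * (B * real (card (Z c)) + \<kappa> * (real (card (Z c)) * deficit (F - S) (Z c)) + 0)"
          unfolding potential_def B_def by (simp add: algebra_simps)
        also have "\<dots> \<le> real (card X) *
          (B * real (card (Z c)) + \<kappa> * (real (card (Z c)) * deficit (F - S) (Z c)) + real (card {y\<in>Z c. bad y}))"
          by (intro mult_left_mono add_left_mono) auto
        finally show ?thesis .
      qed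
    qed
    have tot: "(\<Sum>c\<in>C. real (card (Z c))) = real (card Y)"
      using sum.group[OF finY finC, of "\<lambda>y. restrict y S" "\<lambda>_. 1::real"] unfolding Z_def C_def by simp
    have tot_bad: "(\<Sum>c\<in>C. real (card {y\<in>Z c. bad y})) = real (card {y\<in>Y. bad y})"
    proof -
      have "{y\<in>Z c. bad y} = {y\<in>{y\<in>Y. bad y}. restrict y S = c}" for c unfolding Z_def by blast
      then show ?thesis
        using sum.group[of "{y\<in>Y. bad y}" C "\<lambda>y. restrict y S" "\<lambda>_. 1::real"] finY finC
        unfolding C_def by auto
    qed
    have "hits W X Y = (\<Sum>c\<in>C. hits W X (Z c))"
      unfolding Z_def using finY finC by (intro hits_group_right) (auto simp: C_def)
    also have "\<dots> \<le> (\<Sum>c\<in>C. real (card X) *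
        (B * real (card (Z c)) + \<kappa> * (real (card (Z c)) * deficit (F - S) (Z c)) + real (card {y\<in>Z c. bad y})))"
      by (intro sum_mono piece)
    also have "\<dots> = real (card X) * (B * real (card Y) + \<kappa> * (\<Sum>c\<in>C. real (card (Z c)) * deficit (F - S) (Z c))
        + real (card {y\<in>Y. bad y}))"
      by (simp only: sum_distrib_left[symmetric] sum.distrib tot tot_bad)
    also have "\<dots> \<le> real (card X) * (B * real (card Y) + \<kappa> * (real (card Y) * deficit F Y)
        + real (card Y) * (real (card S) * reveal_risk))"
      using sum_slices_deficit_le[OF finY S F Y] card_bad \<kappa>_nonneg
      unfolding C_def Z_def by (intro mult_left_mono add_mono order_refl) auto
    also have "\<dots> = real (card X) * real (card Y) *
      (A + real (card ?I) / M + \<kappa> * (deficit (F - S) X + deficit F Y) + \<kappa> + real (card S) * reveal_risk)"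
      unfolding B_def by (simp add: algebra_simps)
    finally show ?thesis .
  qed
qed

section \<open>Restoring density after a message\<close>

lemma slice_Un:
  "S \<inter> T = {} \<Longrightarrow> slice (slice X S \<alpha>) T \<beta> = slice X (S \<union> T) (\<lambda>i. if i \<in> S then \<alpha> i else \<beta> i)"
  unfolding slice_def by (auto; metis disjoint_iff)

text \<open>\<open>S\<close> is chosen maximal among the sets with an over-represented pattern. A
  further violation on \<open>T\<close> inside the slice would combine with it to a violation on
  \<open>S \<union> T\<close>.\<close>

lemma obtain_restoring_slice:
  assumes F: "F \<subseteq> {..<k}" and nd: "\<not> dense F X"
  obtains S \<alpha> where "S \<subseteq> F" "real (card X) < real (card (slice X S \<alpha>)) * real N powr (\<delta> * real (card S))"
    "dense (F - S) (slice X S \<alpha>)"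
proof -
  define V where "V = {S. S \<subseteq> F \<and> (\<exists>\<alpha>. real (card X) < real (card (slice X S \<alpha>)) * real N powr (\<delta> * real (card S)))}"
  have finF: "finite F" by (rule finite_subset[OF F]) simp
  have finV: "finite V" unfolding V_def by (rule finite_subset[of _ "Pow F"]) (use finF in auto)
  have "V \<noteq> {}" using nd unfolding dense_def V_def by (auto simp: not_le)
  then obtain S where S: "S \<in> V" "\<And>T. T \<in> V \<Longrightarrow> S \<subseteq> T \<Longrightarrow> S = T"
    using finite_has_maximal[OF finV] by blast
  then obtain \<alpha> where \<alpha>: "S \<subseteq> F" "real (card X) < real (card (slice X S \<alpha>)) * real N powr (\<delta> * real (card S))"
    unfolding V_def by blast
  have "dense (F - S) (slice X S \<alpha>)"
    unfolding dense_def
  proof (intro allI impI, rule ccontr)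
    fix T \<beta> assume T: "T \<subseteq> F - S"
      and "\<not> real (card (slice (slice X S \<alpha>) T \<beta>)) * real N powr (\<delta> * real (card T)) \<le> real (card (slice X S \<alpha>))"
    then have viol: "real (card (slice X S \<alpha>)) < real (card (slice (slice X S \<alpha>) T \<beta>)) * real N powr (\<delta> * real (card T))"
      by simp
    have disj: "S \<inter> T = {}" using T by blast
    have "finite S" "finite T" using \<alpha>(1) T finF by (auto intro: finite_subset)
    then have cardU: "card (S \<union> T) = card S + card T" using disj by (simp add: card_Un_disjoint)
    \<comment> \<open>For empty \<open>T\<close> the slice is the whole set and the power is 1, so
      nothing would be violated.\<close>
    have "T \<noteq> {}" using viol N_ge by (auto simp: slice_def)
    let ?\<gamma> = "\<lambda>i. if i \<in> S then \<alpha> i else \<beta> i"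
    have "real (card X) < real (card (slice X S \<alpha>)) * real N powr (\<delta> * real (card S))" by (fact \<alpha>(2))
    also have "\<dots> \<le> (real (card (slice (slice X S \<alpha>) T \<beta>)) * real N powr (\<delta> * real (card T))) * real N powr (\<delta> * real (card S))"
      using viol by (intro mult_right_mono) auto
    also have "\<dots> = real (card (slice X (S \<union> T) ?\<gamma>)) * real N powr (\<delta> * real (card (S \<union> T)))"
      by (simp add: slice_Un[OF disj] cardU distrib_left powr_add mult_ac)
    finally have "S \<union> T \<in> V" using \<alpha>(1) T unfolding V_def by blast
    then have "S = S \<union> T" using S(2) by blast
    then show False using disj \<open>T \<noteq> {}\<close> by blast
  qed
  then show ?thesis using that \<alpha> by blast
qed

text \<open>Strong induction on \<open>card X\<close>: a dense \<open>X\<close> is covered by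
  \<open>D\<close>, otherwise a restoring slice \<open>X'\<close> is split off and the smaller rest
  \<open>X''\<close> remains. On \<open>X'\<close> the plain potential suffices, so its share
  \<open>\<kappa> * card X'\<close> of the surcharge is free to absorb the growth of the deficit of
  \<open>X''\<close>.\<close>

lemma half_dense_bound_step:
  assumes Q: "few_conflicts k N \<Delta> Q" and A: "0 \<le> A" and D: "dense_bound Q W A"
    and smaller: "\<And>S. S \<subseteq> F \<Longrightarrow> S \<noteq> {} \<Longrightarrow> half_dense_bound (transpose_conflict Q) (\<lambda>y x. W x y) A (F - S)"
  shows "half_dense_bound Q W A F"
proof -
  have "hits W X Y \<le> real (card X) * real (card Y) * (potential A F X Y + \<kappa>)"
    if "state Q F X Y" "dense F Y" "card X = n" for X Y n
    using that
  proof (induction n arbitrary: X rule: less_induct)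
    case (less n)
    note st = less.prems(1) and dY = less.prems(2)
    have F: "F \<subseteq> {..<k}" and X: "X \<subseteq> cube" and sX: "settled F X"
      using st unfolding state_def by auto
    have finX: "finite X" using X by (rule finite_subset_cube)
    show ?case
    proof (cases "dense F X")
      case True
      then have "hits W X Y \<le> real (card X) * real (card Y) * potential A F X Y"
        using D st dY unfolding dense_bound_def by blast
      also have "\<dots> \<le> real (card X) * real (card Y) * (potential A F X Y + \<kappa>)"
        using \<kappa>_nonneg by (intro mult_left_mono) auto
      finally show ?thesis .
    next
      case False
      then obtain S \<alpha> where S: "S \<subseteq> F"
        and big: "real (card X) < real (card (slice X S \<alpha>)) * real N powr (\<delta> * real (card S))"
        and dX': "dense (F - S) (slice X S \<alpha>)"
        using obtain_restoring_slice[OF F] by blast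
      define X' where "X' = slice X S \<alpha>"
      define X'' where "X'' = X - X'"
      have "S \<noteq> {}" using big N_ge by (auto simp: slice_def)
      have "X' \<noteq> {}" using big unfolding X'_def by auto
      have sub: "X' \<subseteq> X" "X'' \<subseteq> X" unfolding X'_def X''_def slice_def by auto
      have fin: "finite X'" "finite X''" using sub finX finite_subset by auto
      have p': "0 < card X'" using \<open>X' \<noteq> {}\<close> fin by (simp add: card_gt_0_iff)
      have sum_card: "real (card X) = real (card X') + real (card X'')"
        using card_Diff_subset[OF fin(1) sub(1)] card_mono[OF finX sub(1)] unfolding X''_def by simp
      have "settled (F - S) X'"
        using sX sub(1) unfolding settled_def X'_def slice_def by auto
      have finS: "finite S" by (rule finite_subset[of _ "{..<k}"]) (use S F in auto)
      then have cS: "1 \<le> real (card S)" using \<open>S \<noteq> {}\<close> by (simp add: Suc_leI card_gt_0_iff)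
      have cF: "real (card (F - S)) = real (card F) - real (card S)"
        using finS S finite_subset[OF F] by (simp add: card_Diff_subset card_mono of_nat_diff)
      have "{..<k} - (F - S) = ({..<k} - F) \<union> S" "({..<k} - F) \<inter> S = {}" using S F by auto
      then have cI: "real (card ({..<k} - (F - S))) = real (card ({..<k} - F)) + real (card S)"
        using finS by (simp add: card_Un_disjoint)
      \<comment> \<open>\<open>X'\<close> has more than a share
        \<open>N powr (- \<delta> * card S)\<close> of \<open>X\<close>, so at most
        \<open>\<delta> * card S * ln N\<close> of entropy is lost while the reference entropy drops
        by \<open>card S * ln N\<close>.\<close>
      have "ln (real (card X)) \<le> ln (real (card X') * real N powr (\<delta> * real (card S)))"
        using big sum_card p' unfolding X'_def by (intro ln_mono) auto
      also have "\<dots> = ln (real (card X')) + \<delta> * real (card S) * ln (real N)"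
        using p' N_ge by (simp add: ln_mult ln_powr)
      finally have gain_def: "deficit (F - S) X' \<le> deficit F X - (1 - \<delta>) * real (card S) * ln (real N)"
        unfolding deficit_def cF by (simp add: algebra_simps)
      \<comment> \<open>This is \<open>gain\<close> times \<open>card S\<close>. Its summand -1
        covers the surcharge \<kappa> for the other player's restoration, because
        \<open>card S\<close> is at least 1.\<close>
      have "real (card S) * (1 / M + reveal_risk) + \<kappa> \<le> real (card S) * (\<kappa> * ((1 - \<delta>) * ln (real N) - 1)) + \<kappa> * real (card S)"
        using gain cS \<kappa>_nonneg unfolding reveal_risk_def
        by (intro add_mono mult_left_mono) (auto simp: mult_le_cancel_left1)
      then have pay: "real (card S) / M + real (card S) * reveal_risk + \<kappa> \<le> \<kappa> * ((1 - \<delta>) * real (card S) * ln (real N))"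
        by (simp add: algebra_simps)
      have "hits W X' Y \<le> real (card X') * real (card Y) *
        (A + real (card ({..<k} - (F - S))) / M + \<kappa> * (deficit (F - S) X' + deficit F Y) + \<kappa> + real (card S) * reveal_risk)"
        using hits_revealed_slice[OF Q A smaller[OF S \<open>S \<noteq> {}\<close>] state_mono[OF st sub(1) order_refl] \<open>X' \<noteq> {}\<close> S
            \<open>settled (F - S) X'\<close> _ dY] dX' unfolding X'_def by blast
      also have "\<dots> \<le> real (card X') * real (card Y) * potential A F X Y"
      proof (intro mult_left_mono)
        have "\<kappa> * deficit (F - S) X' \<le> \<kappa> * (deficit F X - (1 - \<delta>) * real (card S) * ln (real N))"
          using gain_def \<kappa>_nonneg by (intro mult_left_mono)
        then show "A + real (card ({..<k} - (F - S))) / M + \<kappa> * (deficit (F - S) X' + deficit F Y) + \<kappa> + real (card S) * reveal_risk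
           \<le> potential A F X Y"
          using pay unfolding potential_def cI by (simp add: algebra_simps add_divide_distrib)
      qed auto
      finally have h': "hits W X' Y \<le> real (card X') * real (card Y) * potential A F X Y" .
      have "card X'' < n" using sum_card p' less.prems(3) by linarith
      then have IH: "hits W X'' Y \<le> real (card X'') * real (card Y) * (potential A F X'' Y + \<kappa>)"
        using less.IH state_mono[OF st sub(2) order_refl] dY by blast
      \<comment> \<open>By \<open>ln u \<le> u - 1\<close>, the deficit of \<open>X''\<close>
        weighted by its size grows by at most \<open>card X - card X''\<close>.\<close>
      have "real (card X'') * (potential A F X'' Y + \<kappa>) \<le> real (card X'') * potential A F X Y + \<kappa> * real (card X)"
      proof (cases "X'' = {}")
        case True
        then show ?thesis using \<kappa>_nonneg by simp
      next
        case False
        then have p'': "0 < card X''" using fin by (simp add: card_gt_0_iff)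
        have "ln (real (card X)) - ln (real (card X'')) = ln (real (card X) / real (card X''))"
          using p'' sum_card by (simp add: ln_div)
        also have "\<dots> \<le> real (card X) / real (card X'') - 1"
          using p'' sum_card by (intro ln_le_minus_one) auto
        finally have "real (card X'') * (ln (real (card X)) - ln (real (card X''))) \<le> real (card X'') * (real (card X) / real (card X'') - 1)"
          by (intro mult_left_mono) auto
        also have "\<dots> = real (card X) - real (card X'')" using p'' by (simp add: field_simps)
        finally have "\<kappa> * (real (card X'') * (deficit F X'' - deficit F X + 1)) \<le> \<kappa> * real (card X)"
          using \<kappa>_nonneg unfolding deficit_def by (intro mult_left_mono) (simp_all add: algebra_simps)
        then show ?thesis unfolding potential_def by (simp add: algebra_simps)
      qed
      then have "real (card Y) * (real (card X'') * (potential A F X'' Y + \<kappa>))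
          \<le> real (card Y) * (real (card X'') * potential A F X Y + \<kappa> * real (card X))"
        by (intro mult_left_mono) auto
      moreover have "hits W X Y = hits W X' Y + hits W X'' Y"
        using sum.subset_diff[OF sub(1) finX] unfolding hits_def X''_def by (simp add: add.commute)
      ultimately show ?thesis
        using h' IH unfolding sum_card by (simp add: algebra_simps)
    qed
  qed
  then show ?thesis unfolding half_dense_bound_def by blast
qed

text \<open>Restoring one side reduces to restoring the other side on fewer free blocks, so both
  bounds are proved together by induction on \<open>F\<close>.\<close>

lemma half_dense_bound_both:
  assumes Q: "few_conflicts k N \<Delta> Q" and A: "0 \<le> A" and D: "dense_bound Q W A" and F: "finite F"
  shows "half_dense_bound Q W A F \<and> half_dense_bound (transpose_conflict Q) (\<lambda>y x. W x y) A F"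
  using F
proof (induction F rule: finite_psubset_induct)
  case (psubset F)
  have IH: "half_dense_bound Q W A (F - S)" "half_dense_bound (transpose_conflict Q) (\<lambda>y x. W x y) A (F - S)"
    if "S \<subseteq> F" "S \<noteq> {}" for S
  proof -
    have "F - S \<subset> F" using that by blast
    then show "half_dense_bound Q W A (F - S)" "half_dense_bound (transpose_conflict Q) (\<lambda>y x. W x y) A (F - S)"
      using psubset.IH by blast+
  qed
  show ?case
  proof
    show "half_dense_bound Q W A F"
      by (rule half_dense_bound_step[OF Q A D IH(2)])
    show "half_dense_bound (transpose_conflict Q) (\<lambda>y x. W x y) A F"
      by (rule half_dense_bound_step[OF few_conflicts_transpose[OF Q] A dense_bound_transpose[OF D]])
        (simp add: IH(1) transpose_conflict_involutive)
  qed
qed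

section \<open>Induction over the protocol tree\<close>

lemma dense_bound_mono:
  assumes "dense_bound Q W A" "A \<le> A'"
  shows "dense_bound Q W A'"
  unfolding dense_bound_def
proof (intro allI impI)
  fix F X Y assume "state Q F X Y" "dense F X" "dense F Y"
  then have "hits W X Y \<le> real (card X) * real (card Y) * potential A F X Y"
    using assms(1) unfolding dense_bound_def by blast
  also have "\<dots> \<le> real (card X) * real (card Y) * potential A' F X Y"
    using assms(2) unfolding potential_def by (intro mult_left_mono) auto
  finally show "hits W X Y \<le> real (card X) * real (card Y) * potential A' F X Y" .
qed

text \<open>One \<kappa> pays for the average deficit, which a split into two classes raises by at
  most \<open>ln 2 \<le> 1\<close>; the other is the surcharge for classes that are no longer
  dense.\<close>

lemma dense_bound_bit:
  assumes Q: "few_conflicts k N \<Delta> Q" and A: "0 \<le> A" and D: "dense_bound Q W0 A" "dense_bound Q W1 A"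
  shows "dense_bound Q (\<lambda>x y. if f x then W1 x y else W0 x y) (A + 2 * \<kappa>)"
  unfolding dense_bound_def
proof (intro allI impI)
  fix F X Y assume st: "state Q F X Y" and dX: "dense F X" and dY: "dense F Y"
  let ?W = "\<lambda>x y. if f x then W1 x y else W0 x y"
  have F: "F \<subseteq> {..<k}" and X: "X \<subseteq> cube" using st unfolding state_def by auto
  have finF: "finite F" by (rule finite_subset[OF F]) simp
  have finX: "finite X" using X by (rule finite_subset_cube)
  let ?X = "\<lambda>b. {x\<in>X. f x = b}"
  have one: "hits ?W (?X b) Y \<le> real (card (?X b)) * real (card Y) * (potential A F (?X b) Y + \<kappa>)" for b
  proof -
    have "hits ?W (?X b) Y = hits (if b then W1 else W0) (?X b) Y"
      unfolding hits_def by (cases b) simp_all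
    moreover have "half_dense_bound Q (if b then W1 else W0) A F"
      using half_dense_bound_both[OF Q A _ finF] D by auto
    moreover have "state Q F (?X b) Y" by (rule state_mono[OF st]) auto
    ultimately show ?thesis using dY unfolding half_dense_bound_def by auto
  qed
  have "hits ?W X Y = (\<Sum>b\<in>UNIV. hits ?W (?X b) Y)"
    using hits_group_left[OF finX, of f UNIV ?W Y] by simp
  also have "\<dots> \<le> (\<Sum>b\<in>UNIV. real (card (?X b)) * real (card Y) * (potential A F (?X b) Y + \<kappa>))"
    by (intro sum_mono one)
  also have "\<dots> = real (card Y) * ((A + real (card ({..<k} - F)) / M + \<kappa> * deficit F Y + \<kappa>) * (\<Sum>b\<in>UNIV. real (card (?X b)))
      + \<kappa> * (\<Sum>b\<in>UNIV. real (card (?X b)) * deficit F (?X b)))"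
    unfolding potential_def by (simp add: UNIV_bool algebra_simps)
  also have "(\<Sum>b\<in>UNIV. real (card (?X b))) = real (card X)"
    using sum.group[OF finX, of UNIV f "\<lambda>_. 1::real"] by simp
  also have "real (card Y) * ((A + real (card ({..<k} - F)) / M + \<kappa> * deficit F Y + \<kappa>) * real (card X)
      + \<kappa> * (\<Sum>b\<in>UNIV. real (card (?X b)) * deficit F (?X b)))
    \<le> real (card Y) * ((A + real (card ({..<k} - F)) / M + \<kappa> * deficit F Y + \<kappa>) * real (card X)
      + \<kappa> * (real (card X) * (deficit F X + 1)))"
  proof (intro mult_left_mono add_left_mono)
    have "(\<Sum>b\<in>UNIV. real (card (?X b)) * deficit F (?X b)) \<le> real (card X) * (deficit F X + ln (real 2))"
      using sum_class_deficit_le[OF finX, of f UNIV 2 "real (card F) * ln (real N)"]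
      unfolding deficit_def by (simp add: algebra_simps)
    also have "\<dots> \<le> real (card X) * (deficit F X + 1)"
      using ln_le_minus_one[of 2] by (intro mult_left_mono) auto
    finally show "(\<Sum>b\<in>UNIV. real (card (?X b)) * deficit F (?X b)) \<le> real (card X) * (deficit F X + 1)" .
  qed (use \<kappa>_nonneg in auto)
  also have "\<dots> = real (card X) * real (card Y) * potential (A + 2 * \<kappa>) F X Y"
    unfolding potential_def by (simp add: algebra_simps)
  finally show "hits ?W X Y \<le> real (card X) * real (card Y) * potential (A + 2 * \<kappa>) F X Y" .
qed

text \<open>Both subtrees are first raised to the larger of their costs, so that one constant serves
  both branches. A bit from Bob is treated as a bit from the first player of the transposed
  problem.\<close>

lemma dense_bound_protocol:
  assumes Q: "few_conflicts k N \<Delta> Q"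
    and leaf: "\<And>r. dense_bound Q (\<lambda>x y. sol x y r) A" and A: "0 \<le> A"
  shows "dense_bound Q (\<lambda>x y. sol x y (run_protocol P x y)) (A + 2 * \<kappa> * real (protocol_cost P))"
proof (induction P)
  case (Output r)
  then show ?case using leaf by simp
next
  case (AliceSends f l r)
  let ?c = "real (max (protocol_cost l) (protocol_cost r))"
  have "dense_bound Q (\<lambda>x y. sol x y (run_protocol l x y)) (A + 2 * \<kappa> * ?c)"
    "dense_bound Q (\<lambda>x y. sol x y (run_protocol r x y)) (A + 2 * \<kappa> * ?c)"
    using AliceSends \<kappa>_nonneg by (auto elim!: dense_bound_mono intro!: mult_left_mono)
  then have "dense_bound Q (\<lambda>x y. if f x then sol x y (run_protocol r x y) else sol x y (run_protocol l x y)) (A + 2 * \<kappa> * ?c + 2 * \<kappa>)"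
    using A \<kappa>_nonneg by (intro dense_bound_bit[OF Q]) auto
  then show ?case by (simp add: algebra_simps if_distrib cong: if_cong)
next
  case (BobSends g l r)
  let ?c = "real (max (protocol_cost l) (protocol_cost r))"
  have "dense_bound Q (\<lambda>x y. sol x y (run_protocol l x y)) (A + 2 * \<kappa> * ?c)"
    "dense_bound Q (\<lambda>x y. sol x y (run_protocol r x y)) (A + 2 * \<kappa> * ?c)"
    using BobSends \<kappa>_nonneg by (auto elim!: dense_bound_mono intro!: mult_left_mono)
  from this[THEN dense_bound_transpose]
  have "dense_bound (transpose_conflict Q) (\<lambda>y x. if g y then sol x y (run_protocol r x y) else sol x y (run_protocol l x y)) (A + 2 * \<kappa> * ?c + 2 * \<kappa>)"
    using A \<kappa>_nonneg by (intro dense_bound_bit[OF few_conflicts_transpose[OF Q]]) auto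
  from dense_bound_transpose[OF this] show ?case
    by (simp add: transpose_conflict_involutive algebra_simps if_distrib cong: if_cong)
qed

section \<open>The initial rectangle\<close>

lemma dense_cube: "dense {..<k} cube"
  unfolding dense_def
proof (intro allI impI)
  fix S :: "nat set" and \<alpha> :: "nat \<Rightarrow> nat" assume S: "S \<subseteq> {..<k}"
  then have finS: "finite S" using finite_subset by blast
  \<comment> \<open>Only an inclusion: if \<alpha> leaves the alphabet on \<open>S\<close>, the
    slice is empty.\<close>
  have "slice cube S \<alpha> \<subseteq> (\<Pi>\<^sub>E i\<in>{..<k}. if i \<in> S then {\<alpha> i} else {..<N})"
    unfolding slice_def input_cube_def by (auto simp: PiE_iff extensional_def)
  then have "card (slice cube S \<alpha>) \<le> card (\<Pi>\<^sub>E i\<in>{..<k}. if i \<in> S then {\<alpha> i} else {..<N})"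
    by (intro card_mono finite_PiE) auto
  also have "\<dots> = (\<Prod>i\<in>{..<k}. if i \<in> S then 1 else N)" by (simp add: card_PiE if_distrib cong: if_cong)
  also have "\<dots> = N ^ card ({..<k} - S)"
    using S by (simp add: prod.If_cases Diff_eq)
  finally have "card (slice cube S \<alpha>) \<le> N ^ (k - card S)"
    using S finS by (simp add: card_Diff_subset)
  moreover have "\<delta> * real (card S) \<le> 1 * real (card S)" using \<delta>_le by (intro mult_right_mono) auto
  ultimately have "real (card (slice cube S \<alpha>)) * real N powr (\<delta> * real (card S)) \<le> real (N ^ (k - card S)) * real N powr (real (card S))"
    using N_ge by (intro mult_mono powr_mono of_nat_mono) auto
  also have "\<dots> = real (N ^ (k - card S) * N ^ card S)"
    using N_ge by (simp add: powr_realpow)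
  also have "N ^ (k - card S) * N ^ card S = card cube"
    using card_mono[OF _ S] by (simp add: input_cube_def card_PiE flip: power_add)
  finally show "real (card (slice cube S \<alpha>)) * real N powr (\<delta> * real (card S)) \<le> real (card cube)" .
qed

lemma card_cube: "card cube = N ^ k"
  by (simp add: input_cube_def card_PiE)

text \<open>Initially no block is fixed and both deficits vanish, so the potential is just
  \<open>A\<close>.\<close>

lemma hits_cube_le:
  assumes "dense_bound Q W A"
  shows "hits W cube cube \<le> real (card cube) * real (card cube) * A"
proof -
  have "state Q {..<k} cube cube" by (simp add: state_def settled_def clean_def)
  then have "hits W cube cube \<le> real (card cube) * real (card cube) * potential A {..<k} cube cube"
    using assms dense_cube unfolding dense_bound_def by blast
  moreover have "deficit {..<k} cube = 0"
    using N_ge by (simp add: deficit_def card_cube ln_realpow)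
  ultimately show ?thesis by (simp add: potential_def)
qed

end

subsection \<open>Success on uniform inputs\<close>

definition nonadjacent :: "(vertex set \<Rightarrow> bool) \<Rightarrow> conflict" where
  "nonadjacent G = (\<lambda>i a b j a' b'. \<not> G {(i, a, b), (j, a', b')})"

lemma hits_le_left:
  assumes "finite X" "\<And>x y. x \<in> X \<Longrightarrow> y \<in> Y \<Longrightarrow> W x y \<Longrightarrow> C x"
  shows "hits W X Y \<le> real (card {x\<in>X. C x}) * real (card Y)"
proof -
  have "hits W X Y \<le> (\<Sum>x\<in>X. \<Sum>y\<in>Y. of_bool (C x))"
    unfolding hits_def using assms(2) by (intro sum_mono) auto
  also have "\<dots> = real (card {x\<in>X. C x}) * real (card Y)"
    using assms(1) by (simp add: Int_def flip: sum_distrib_left)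
  finally show ?thesis .
qed

context density_walk
begin

text \<open>If the answer is correct anywhere on a clean rectangle, one of its two blocks,
  \<open>h\<close>, is free. The answer prescribes Alice's symbol in \<open>h\<close>, so the
  density of \<open>X\<close> alone gives the bound.\<close>

lemma dense_bound_output:
  "dense_bound (nonadjacent G) (\<lambda>x y. search_solution k G x y r) (real N powr (- \<delta>))"
  unfolding dense_bound_def
proof (intro allI impI)
  fix F X Y assume st: "state (nonadjacent G) F X Y" and dX: "dense F X" and dY: "dense F Y"
  let ?W = "\<lambda>x y. search_solution k G x y r"
  have finX: "finite X" using st finite_subset_cube unfolding state_def by blast
  show "hits ?W X Y \<le> real (card X) * real (card Y) * potential (real N powr (- \<delta>)) F X Y"
  proof (cases "\<exists>x\<in>X. \<exists>y\<in>Y. ?W x y")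
    case False
    then have "hits ?W X Y = 0" unfolding hits_def by simp
    moreover have "0 \<le> real (card X) * real (card Y) * potential (real N powr (- \<delta>)) F X Y"
    proof (cases "X = {} \<or> Y = {}")
      case True
      then show ?thesis by auto
    next
      case False
      then show ?thesis using potential_nonneg[OF st] by simp
    qed
    ultimately show ?thesis by simp
  next
    case True
    then obtain x y where xy: "x \<in> X" "y \<in> Y" "?W x y" by blast
    then obtain i j where ij: "i < k" "j < k" "i \<noteq> j" "fst r = (i, x i, y i)" "snd r = (j, x j, y j)" "\<not> G {fst r, snd r}"
      unfolding search_solution_def by blast
    have "i \<in> F \<or> j \<in> F"
    proof (rule ccontr)
      assume "\<not> (i \<in> F \<or> j \<in> F)"
      then have "\<not> nonadjacent G i (x i) (y i) j (x j) (y j)"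
        using st xy(1,2) ij(1-3) unfolding state_def clean_def by blast
      then show False using ij(6) unfolding ij(4,5) nonadjacent_def by simp
    qed
    then obtain h where h: "h \<in> F" "h = i \<or> h = j" by blast
    have "x' h = x h" if "?W x' y'" for x' y'
      using that ij h unfolding search_solution_def by auto
    then have "hits ?W X Y \<le> real (card {x'\<in>X. x' h = x h}) * real (card Y)"
      by (intro hits_le_left[OF finX])
    also have "\<dots> \<le> (real (card X) * real N powr (- \<delta>)) * real (card Y)"
      by (intro mult_right_mono card_coordinate_le[OF dX h(1)]) auto
    also have "\<dots> \<le> real (card X) * real (card Y) * potential (real N powr (- \<delta>)) F X Y"
    proof -
      have "real N powr (- \<delta>) \<le> potential (real N powr (- \<delta>)) F X Y"
        using potential_nonneg[OF st, of 0] xy unfolding potential_def by auto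
      then have "(real (card X) * real (card Y)) * real N powr (- \<delta>)
          \<le> (real (card X) * real (card Y)) * potential (real N powr (- \<delta>)) F X Y"
        by (intro mult_left_mono) auto
      then show ?thesis by (simp only: mult_ac)
    qed
    finally show ?thesis .
  qed
qed

lemma hits_search_le:
  assumes "few_conflicts k N \<Delta> (nonadjacent G)"
  shows "hits (\<lambda>x y. search_solution k G x y (run_protocol P x y)) cube cube
    \<le> real (card cube) * real (card cube) * (real N powr (- \<delta>) + 2 * \<kappa> * real (protocol_cost P))"
  by (rule hits_cube_le[OF dense_bound_protocol[OF assms dense_bound_output]]) simp

end

text \<open>Yao's averaging argument for the uniform distribution on inputs.\<close>

lemma solves_search_imp_success:
  assumes R: "solves_search n k G R" and n: "0 < sigma_size n"
    and le: "\<And>P. P \<in> set_pmf R \<Longrightarrow>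
      hits (\<lambda>x y. search_solution k G x y (run_protocol P x y))
        (input_cube k (sigma_size n)) (input_cube k (sigma_size n))
      \<le> real (card (input_cube k (sigma_size n))) * real (card (input_cube k (sigma_size n))) * r"
  shows "2 / 3 \<le> r"
proof -
  let ?C = "input_cube k (sigma_size n)"
  let ?c = "real (card ?C)"
  let ?S = "\<lambda>P x y. search_solution k G x y (run_protocol P x y)"
  have c: "0 < ?c" using n by (simp add: input_cube_def card_PiE)
  have int: "integrable (measure_pmf R) (\<lambda>P. of_bool (?S P x y) :: real)" for x y
    by (rule measure_pmf.integrable_const_bound[where B = 1]) auto
  have prob: "measure_pmf.expectation R (\<lambda>P. of_bool (?S P x y)) = measure_pmf.prob R {P. ?S P x y}" for x y
  proof -
    have "(\<lambda>P. of_bool (?S P x y) :: real) = indicator {P. ?S P x y}" by (auto simp: indicator_def)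
    then show ?thesis by simp
  qed
  have "?c * ?c * (2 / 3) = (\<Sum>x\<in>?C. \<Sum>y\<in>?C. 2 / 3)" by simp
  also have "\<dots> \<le> (\<Sum>x\<in>?C. \<Sum>y\<in>?C. measure_pmf.expectation R (\<lambda>P. of_bool (?S P x y)))"
    unfolding prob using R by (intro sum_mono) (auto simp: solves_search_def valid_input_def input_cube_def PiE_iff)
  also have "\<dots> = measure_pmf.expectation R (\<lambda>P. hits (?S P) ?C ?C)"
    unfolding hits_def by (simp add: int)
  also have "\<dots> \<le> measure_pmf.expectation R (\<lambda>P. ?c * ?c * r)"
  proof (rule integral_mono_AE)
    show "integrable (measure_pmf R) (\<lambda>P. hits (?S P) ?C ?C)" unfolding hits_def by (simp add: int)
  qed (use le in \<open>auto intro!: AE_pmfI\<close>)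
  also have "\<dots> = ?c * ?c * r" by simp
  finally show ?thesis using c by simp
qed

subsection \<open>Non-neighbours in the random graph\<close>

text \<open>Chernoff bound by the exponential Markov inequality with parameter 1. Injectivity of
  \<open>e\<close> makes the events independent, and each edge contributes \<open>p + (1 - p) * exp
  1 \<le> 1 + 2 * (1 - p) \<le> exp (2 * (1 - p))\<close>.\<close>

lemma Pi_bernoulli_absent_tail:
  fixes p \<Delta> :: real
  assumes E: "finite E" and B: "finite B" "inj_on e B" "e ` B \<subseteq> E" and p: "0 \<le> p" "p \<le> 1"
  shows "measure_pmf.prob (Pi_pmf E d (\<lambda>_. bernoulli_pmf p)) {G. \<Delta> < real (card {b\<in>B. \<not> G (e b)})}
    \<le> exp (2 * (1 - p) * real (card B) - \<Delta>)"
proof -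
  \<comment> \<open>Writes \<open>exp\<close> of the number of absent edges as a product over all of
    \<open>E\<close>, with factor 1 outside the image of \<open>B\<close>, to fit the product rule
    for \<open>Pi_pmf\<close>.\<close>
  define f where "f v = (\<lambda>g. if v \<in> e ` B \<and> \<not> g then exp 1 else 1 :: real)" for v
  let ?M = "Pi_pmf E d (\<lambda>_. bernoulli_pmf p)"
  have prod_f: "(\<Prod>v\<in>E. f v (G v)) = exp (real (card {b\<in>B. \<not> G (e b)}))" for G
  proof -
    have "(\<Prod>v\<in>E. f v (G v)) = (\<Prod>v\<in>e ` B. f v (G v))"
      using E B(3) by (intro prod.mono_neutral_right) (auto simp: f_def)
    also have "\<dots> = (\<Prod>b\<in>B. f (e b) (G (e b)))"
      using B(2) by (simp add: prod.reindex)
    also have "\<dots> = (\<Prod>b\<in>B. if \<not> G (e b) then exp 1 else 1)"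
      by (intro prod.cong) (auto simp: f_def)
    also have "\<dots> = (\<Prod>b\<in>{b\<in>B. \<not> G (e b)}. exp 1)"
      by (rule prod.inter_filter[symmetric, OF B(1)])
    finally show ?thesis by (simp add: exp_of_nat_mult[symmetric])
  qed
  have int: "integrable (measure_pmf ?M) (\<lambda>G. \<Prod>v\<in>E. f v (G v))"
    unfolding prod_f
    by (rule measure_pmf.integrable_const_bound[where B = "exp (real (card B))"])
      (use B in \<open>auto intro!: AE_pmfI card_mono\<close>)
  have "measure_pmf.prob ?M {G. \<Delta> < real (card {b\<in>B. \<not> G (e b)})}
     \<le> measure_pmf.prob ?M {G\<in>space (measure_pmf ?M). exp \<Delta> \<le> (\<Prod>v\<in>E. f v (G v))}"
    unfolding prod_f by (intro measure_pmf.finite_measure_mono) auto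
  also have "\<dots> \<le> measure_pmf.expectation ?M (\<lambda>G. \<Prod>v\<in>E. f v (G v)) / exp \<Delta>"
    by (rule integral_Markov_inequality_measure[OF int, of UNIV]) (auto intro!: AE_pmfI prod_nonneg simp: f_def)
  also have "measure_pmf.expectation ?M (\<lambda>G. \<Prod>v\<in>E. f v (G v))
      = (\<Prod>v\<in>E. measure_pmf.expectation (bernoulli_pmf p) (f v))"
    using E by (intro expectation_prod_Pi_pmf integrable_measure_pmf_finite) (auto simp: f_def)
  also have "\<dots> = (\<Prod>v\<in>e ` B. measure_pmf.expectation (bernoulli_pmf p) (f v))"
    using E B(3) by (intro prod.mono_neutral_right) (auto simp: f_def)
  also have "\<dots> \<le> (\<Prod>v\<in>e ` B. exp (2 * (1 - p)))"
  proof (intro prod_mono conjI)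
    fix v assume v: "v \<in> e ` B"
    have eq: "measure_pmf.expectation (bernoulli_pmf p) (f v) = p + (1 - p) * exp 1"
      using v p by (simp add: f_def)
    show "0 \<le> measure_pmf.expectation (bernoulli_pmf p) (f v)"
      using p unfolding eq by simp
    have "(1 - p) * exp 1 \<le> (1 - p) * 3" using p exp_le by (intro mult_left_mono) auto
    then have "p + (1 - p) * exp 1 \<le> 1 + 2 * (1 - p)" by simp
    also have "\<dots> \<le> exp (2 * (1 - p))" by (rule exp_ge_add_one_self)
    finally show "measure_pmf.expectation (bernoulli_pmf p) (f v) \<le> exp (2 * (1 - p))" unfolding eq .
  qed
  also have "\<dots> = exp (2 * (1 - p) * real (card B))"
    using B(2) by (simp add: card_image exp_of_nat_mult[symmetric] mult_ac)
  finally show ?thesis by (simp add: exp_diff divide_right_mono)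
qed

lemma finite_potential_edges: "finite (potential_edges n k)"
proof -
  have "vertices n k \<subseteq> {..<k} \<times> {..<sigma_size n} \<times> {..<sigma_size n}"
    unfolding vertices_def by auto
  then have "finite (vertices n k)" by (rule finite_subset) simp
  moreover have "potential_edges n k \<subseteq> Pow (vertices n k)" unfolding potential_edges_def by auto
  ultimately show ?thesis by (meson finite_Pow_iff finite_subset)
qed

text \<open>Union bound over at most \<open>2 * k^2 * N^3\<close> choices of a row or column and a
  vertex. The summand \<open>4 * ln (k * N^2)\<close> of \<Delta> makes each fail with probability
  at most \<open>1 / (k * N^2)^4\<close>, which brings the total below \<open>2 / N\<close>
  uniformly in \<open>k\<close>.\<close>

lemma random_graph_few_conflicts:
  assumes p: "0 \<le> p" "p \<le> 1" and N: "sigma_size n = N" "1 \<le> N" and k: "1 \<le> k"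
    and \<Delta>: "\<Delta> = 2 * (1 - p) * real N + 4 * ln (real k * (real N)\<^sup>2)"
  shows "1 - 2 / real N \<le> measure_pmf.prob (random_graph n k p) {G. few_conflicts k N \<Delta> (nonadjacent G)}"
proof -
  let ?M = "random_graph n k p"
  \<comment> \<open>Indexes a line of block \<open>i\<close> and a vertex of block \<open>j\<close>;
    for \<open>i = j\<close> the events below are empty, so a plain product can be used.\<close>
  define T where "T = {..<k} \<times> {..<k} \<times> {..<N} \<times> {..<N} \<times> {..<N}"
  define U where "U = (\<lambda>(i::nat, j::nat, a::nat, a'::nat, b'::nat). {G :: vertex set \<Rightarrow> bool. i \<noteq> j \<and> \<Delta> < real (card {b\<in>{..<N}. \<not> G {(i, a, b), (j, a', b')}})})"
  define V where "V = (\<lambda>(i::nat, j::nat, b::nat, a'::nat, b'::nat). {G :: vertex set \<Rightarrow> bool. i \<noteq> j \<and> \<Delta> < real (card {a\<in>{..<N}. \<not> G {(i, a, b), (j, a', b')}})})"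
  have kN: "1 \<le> real k * (real N)\<^sup>2" using k N(2) mult_mono[of 1 "real k" 1 "(real N)\<^sup>2"] by simp
  define q where "q = 1 / (real k * (real N)\<^sup>2) ^ 4"
  have q: "exp (2 * (1 - p) * real (card {..<N}) - \<Delta>) = q"
  proof -
    have "2 * (1 - p) * real (card {..<N}) - \<Delta> = - (4 * ln (real k * (real N)\<^sup>2))"
      unfolding \<Delta> by simp
    then show ?thesis unfolding q_def using kN exp_of_nat_mult[of 4 "ln (real k * (real N)\<^sup>2)"]
      by (simp add: exp_minus inverse_eq_divide)
  qed
  have tail: "measure_pmf.prob ?M {G. \<Delta> < real (card {b\<in>{..<N}. \<not> G (e b)})} \<le> q"
    if "inj_on e {..<N}" "e ` {..<N} \<subseteq> potential_edges n k" for e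
    using Pi_bernoulli_absent_tail[OF finite_potential_edges finite_lessThan that p, where d = False and \<Delta> = \<Delta>] q
    unfolding random_graph_def by simp
  have U: "measure_pmf.prob ?M (U z) \<le> q" if z: "z \<in> T" for z
  proof -
    obtain i j a a' b' where z_eq: "z = (i, j, a, a', b')" by (cases z) auto
    show ?thesis
    proof (cases "i = j")
      case True
      then show ?thesis unfolding U_def z_eq q_def by simp
    next
      case False
      have "measure_pmf.prob ?M {G. \<Delta> < real (card {b\<in>{..<N}. \<not> G {(i, a, b), (j, a', b')}})} \<le> q"
      proof (rule tail)
        show "inj_on (\<lambda>b. {(i, a, b), (j, a', b')}) {..<N}"
          using False by (auto simp: inj_on_def doubleton_eq_iff)
        show "(\<lambda>b. {(i, a, b), (j, a', b')}) ` {..<N} \<subseteq> potential_edges n k"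
          using False z unfolding z_eq T_def potential_edges_def vertices_def N(1)
          by (fastforce)
      qed
      then show ?thesis using False unfolding U_def z_eq by simp
    qed
  qed
  have V: "measure_pmf.prob ?M (V z) \<le> q" if z: "z \<in> T" for z
  proof -
    obtain i j b a' b' where z_eq: "z = (i, j, b, a', b')" by (cases z) auto
    show ?thesis
    proof (cases "i = j")
      case True
      then show ?thesis unfolding V_def z_eq q_def by simp
    next
      case False
      have "measure_pmf.prob ?M {G. \<Delta> < real (card {a\<in>{..<N}. \<not> G {(i, a, b), (j, a', b')}})} \<le> q"
      proof (rule tail)
        show "inj_on (\<lambda>a. {(i, a, b), (j, a', b')}) {..<N}"
          using False by (auto simp: inj_on_def doubleton_eq_iff)
        show "(\<lambda>a. {(i, a, b), (j, a', b')}) ` {..<N} \<subseteq> potential_edges n k"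
          using False z unfolding z_eq T_def potential_edges_def vertices_def N(1)
          by (fastforce)
      qed
      then show ?thesis using False unfolding V_def z_eq by simp
    qed
  qed
  have "- {G. few_conflicts k N \<Delta> (nonadjacent G)} \<subseteq> (\<Union>z\<in>T. U z) \<union> (\<Union>z\<in>T. V z)"
  proof (rule subsetI, rule ccontr)
    fix G assume bad: "G \<in> - {G. few_conflicts k N \<Delta> (nonadjacent G)}"
      and "G \<notin> (\<Union>z\<in>T. U z) \<union> (\<Union>z\<in>T. V z)"
    then have notU: "\<And>z. z \<in> T \<Longrightarrow> G \<notin> U z" and notV: "\<And>z. z \<in> T \<Longrightarrow> G \<notin> V z" by blast+
    have "few_conflicts k N \<Delta> (nonadjacent G)"
      unfolding few_conflicts_def
    proof (intro conjI allI impI)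
      show "nonadjacent G j a' b' i a b" if "nonadjacent G i a b j a' b'" for i a b j a' b'
        using that unfolding nonadjacent_def by (simp add: insert_commute)
      show "real (card {b. b < N \<and> nonadjacent G i a b j a' b'}) \<le> \<Delta>"
        if "i < k" "j < k" "i \<noteq> j" "a < N" "a' < N" "b' < N" for i j a a' b'
        using notU[of "(i, j, a, a', b')"] that unfolding T_def U_def nonadjacent_def by (simp add: not_less)
      show "real (card {a. a < N \<and> nonadjacent G i a b j a' b'}) \<le> \<Delta>"
        if "i < k" "j < k" "i \<noteq> j" "b < N" "a' < N" "b' < N" for i j b a' b'
        using notV[of "(i, j, b, a', b')"] that unfolding T_def V_def nonadjacent_def by (simp add: not_less)
    qed
    then show False using bad by simp
  qed
  then have "measure_pmf.prob ?M (- {G. few_conflicts k N \<Delta> (nonadjacent G)})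
     \<le> measure_pmf.prob ?M ((\<Union>z\<in>T. U z) \<union> (\<Union>z\<in>T. V z))"
    by (intro measure_pmf.finite_measure_mono) auto
  also have "\<dots> \<le> measure_pmf.prob ?M (\<Union>z\<in>T. U z) + measure_pmf.prob ?M (\<Union>z\<in>T. V z)"
    by (rule measure_Un_le) auto
  also have "\<dots> \<le> (\<Sum>z\<in>T. measure_pmf.prob ?M (U z)) + (\<Sum>z\<in>T. measure_pmf.prob ?M (V z))"
    by (intro add_mono measure_pmf.finite_measure_subadditive_finite) (auto simp: T_def)
  also have "\<dots> \<le> (\<Sum>z\<in>T. q) + (\<Sum>z\<in>T. q)" by (intro add_mono sum_mono U V)
  also have "\<dots> = 2 * ((real k)\<^sup>2 * real N ^ 3) * q"
    by (simp add: T_def card_cartesian_product power2_eq_square power3_eq_cube)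
  also have "\<dots> \<le> 2 / real N"
  proof -
    have "1 \<le> (real k)\<^sup>2 * real N ^ 4"
      using k N(2) mult_mono[of 1 "(real k)\<^sup>2" 1 "real N ^ 4"] by simp
    then have "(real k)\<^sup>2 * real N ^ 4 * 1 \<le> (real k)\<^sup>2 * real N ^ 4 * ((real k)\<^sup>2 * real N ^ 4)"
      by (intro mult_left_mono) auto
    also have "\<dots> = (real k * (real N)\<^sup>2) ^ 4" by (simp add: eval_nat_numeral)
    finally have "real N * ((real k)\<^sup>2 * real N ^ 3) \<le> (real k * (real N)\<^sup>2) ^ 4"
      by (simp add: eval_nat_numeral mult_ac)
    moreover have "0 < (real k * (real N)\<^sup>2) ^ 4" using kN by (intro zero_less_power) linarith
    ultimately have "real N * ((real k)\<^sup>2 * real N ^ 3) * q \<le> 1"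
      unfolding q_def by (simp only: times_divide_eq_right mult_1_right divide_le_eq_1_pos)
    then show ?thesis using N(2) by (simp add: field_simps)
  qed
  finally have "measure_pmf.prob ?M (- {G. few_conflicts k N \<Delta> (nonadjacent G)}) \<le> 2 / real N" .
  then show ?thesis
    using measure_pmf.prob_compl[of "{G. few_conflicts k N \<Delta> (nonadjacent G)}" ?M] by (simp add: Compl_eq_Diff_UNIV)
qed

subsection \<open>Choice of parameters\<close>

text \<open>With \<delta> = 19/20 the exponent \<open>1 - 2 * \<delta>\<close> is -9/10. Up to
  constants, \<open>\<kappa> * d\<close> consists of \<open>d / M\<close>,
  \<open>d * M * \<epsilon> * N powr (1/10)\<close> and
  \<open>d * M * ln (k * N^2) * N powr (- 9/10)\<close>; for \<open>M\<close> of order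
  \<open>d + 1\<close> the last two are controlled by \<open>d_\<epsilon>\<close> and
  \<open>d_log\<close>.\<close>

lemma hits_search_le_third:
  fixes N k :: nat and \<epsilon> \<Delta> :: real
  assumes N: "2 ^ 80 \<le> N" and k: "1 \<le> k" and \<epsilon>: "0 \<le> \<epsilon>"
    and \<Delta>: "\<Delta> = 2 * \<epsilon> * real N + 4 * ln (real k * (real N)\<^sup>2)"
    and G: "few_conflicts k N \<Delta> (nonadjacent G)"
    and d: "d = real (protocol_cost P)"
    and d_\<epsilon>: "d\<^sup>2 * (\<epsilon> * real N powr (1/10)) \<le> 1 / 4096"
    and d_log: "d * log 2 (real k * (real N)\<^sup>2) \<le> real N powr (9/20) / 64"
  shows "hits (\<lambda>x y. search_solution k G x y (run_protocol P x y)) (input_cube k N) (input_cube k N)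
    \<le> real (card (input_cube k N)) * real (card (input_cube k N)) * (1/3)"
proof -
  \<comment> \<open>\<open>M\<close> keeps \<open>d / M\<close> at most 1/16 and is positive even
    for \<open>d = 0\<close>. The value of \<kappa> satisfies \<open>gain\<close> because
    \<open>N \<ge> 2 ^ 80\<close> makes \<open>(1 - \<delta>) * ln N - 1\<close> at least 1.\<close>
  define M where "M = 16 * (d + 1)"
  define \<kappa> where "\<kappa> = 1 / M + M * \<Delta> * real N powr (1 - 2 * (19/20))"
  have d0: "0 \<le> d" using d by simp
  then have M: "0 < M" unfolding M_def by simp
  have N2: "2 ^ 80 \<le> real N" using N by (metis of_nat_le_iff of_nat_numeral of_nat_power)
  have "(2::real) \<le> 2 ^ 80" by simp
  then have N1: "2 \<le> real N" using N2 by linarith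
  have "1 * 4 \<le> real k * (real N)\<^sup>2"
    using k N1 power_mono[of 2 "real N" 2] by (intro mult_mono) auto
  then have kN: "4 \<le> real k * (real N)\<^sup>2" by simp
  define L where "L = log 2 (real k * (real N)\<^sup>2)"
  have "log 2 2 \<le> L" unfolding L_def using kN by (intro log_mono) auto
  then have L: "1 \<le> L" by simp
  have ln2: "0 < ln (2::real)" "ln (2::real) \<le> 1" using ln_le_minus_one[of 2] by auto
  have "ln (real k * (real N)\<^sup>2) = L * ln 2" unfolding L_def using ln2 by (simp add: log_def)
  also have "\<dots> \<le> L" using L ln2 by (simp add: mult_left_le)
  finally have ln_le: "ln (real k * (real N)\<^sup>2) \<le> L" .
  have \<Delta>0: "0 \<le> \<Delta>" unfolding \<Delta> using \<epsilon> kN by simp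
  have \<kappa>0: "0 \<le> \<kappa>" unfolding \<kappa>_def using M \<Delta>0 by simp
  have "80 * ln 2 = ln ((2::real) ^ 80)" using ln_realpow[of 2 80] by simp
  also have "\<dots> \<le> ln (real N)" using N2 by (intro ln_mono) auto
  finally have lnN: "80 * ln 2 \<le> ln (real N)" .
  have "(1/2::real) \<le> ln 2" using ln_le_minus_one[of "1/2::real"] by (simp add: ln_div)
  then have "1 \<le> (1 - 19/20) * ln (real N) - 1" using lnN by simp
  then have gain: "\<kappa> \<le> \<kappa> * ((1 - 19/20) * ln (real N) - 1)"
    using \<kappa>0 by (simp add: mult_le_cancel_left1)
  interpret density_walk k N "19/20" M \<Delta> \<kappa>
    by standard (use N1 M \<Delta>0 \<kappa>0 gain in \<open>auto simp: \<kappa>_def\<close>)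
  have e1: "1 - 2 * (19/20) = (- (9/10)::real)" by simp
  \<comment> \<open>As a cost, \<open>d\<close> is an integer: it is 0, or at least 1 and then
    \<open>d + 1 \<le> 2 * d\<close>.\<close>
  have dM: "d * M \<le> 32 * d\<^sup>2"
  proof (cases "protocol_cost P = 0")
    case True
    then show ?thesis using d by simp
  next
    case False
    then have "1 \<le> d" using d by simp
    then have "d * 1 \<le> d * d" using d0 by (intro mult_left_mono) auto
    then show ?thesis unfolding M_def by (simp add: power2_eq_square algebra_simps)
  qed
  have first: "d / M \<le> 1 / 16" unfolding M_def using d0 by (simp add: field_simps)
  have \<epsilon>_part: "d\<^sup>2 * (\<epsilon> * real N * real N powr (- (9/10))) \<le> 1 / 4096"
  proof -
    have "real N * real N powr (- (9/10)) = real N powr (1/10)"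
      using N1 powr_add[of "real N" 1 "- (9/10)"] by simp
    then show ?thesis using d_\<epsilon> by (simp add: mult_ac)
  qed
  have log_part: "d\<^sup>2 * (ln (real k * (real N)\<^sup>2) * real N powr (- (9/10))) \<le> 1 / 4096"
  proof -
    \<comment> \<open>Since \<open>L \<ge> 1\<close>, the logarithm can be replaced by the square of
      \<open>L\<close>, which lets \<open>d_log\<close> be applied in squared form.\<close>
    have "ln (real k * (real N)\<^sup>2) \<le> L\<^sup>2"
      using ln_le L self_le_power[of L 2] by simp
    then have "d\<^sup>2 * (ln (real k * (real N)\<^sup>2) * real N powr (- (9/10))) \<le> d\<^sup>2 * (L\<^sup>2 * real N powr (- (9/10)))"
      by (intro mult_left_mono mult_right_mono) auto
    also have "\<dots> = (d * L)\<^sup>2 * real N powr (- (9/10))" by (simp add: power_mult_distrib)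
    also have "\<dots> \<le> (real N powr (9/20) / 64)\<^sup>2 * real N powr (- (9/10))"
      using d_log d0 L unfolding L_def[symmetric] by (intro mult_right_mono power_mono) auto
    also have "\<dots> = (real N powr (9/20) * real N powr (9/20) * real N powr (- (9/10))) / 4096"
      by (simp add: power2_eq_square)
    also have "\<dots> = 1 / 4096" using N1 by (simp flip: powr_add)
    finally show ?thesis .
  qed
  have "2 * \<kappa> * d = 2 * (d / M) + 2 * (d * M) * (\<Delta> * real N powr (- (9/10)))"
    unfolding \<kappa>_def e1 by (simp add: algebra_simps)
  also have "\<dots> \<le> 2 * (1 / 16) + 2 * (32 * d\<^sup>2) * (\<Delta> * real N powr (- (9/10)))"
    using first dM \<Delta>0 by (intro add_mono mult_left_mono mult_right_mono) auto
  also have "\<dots> = 1 / 8 + 128 * (d\<^sup>2 * (\<epsilon> * real N * real N powr (- (9/10))))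
      + 256 * (d\<^sup>2 * (ln (real k * (real N)\<^sup>2) * real N powr (- (9/10))))"
    unfolding \<Delta> by (simp add: algebra_simps)
  \<comment> \<open>The sum is 7/32; the leaf term, at most 1/16, still leaves the total below
    1/3.\<close>
  also have "\<dots> \<le> 1 / 8 + 128 * (1 / 4096) + 256 * (1 / 4096)"
    using \<epsilon>_part log_part by linarith
  finally have \<kappa>_part: "2 * \<kappa> * d \<le> 7 / 32" by simp
  have "real N powr (- (19/20)) \<le> real N powr (- (1/2))" using N1 by (intro powr_mono) auto
  also have "\<dots> \<le> (2 ^ 80) powr (- (1/2))" using N2 by (intro powr_mono2') auto
  also have "(2::real) ^ 80 = 2 powr 80" using powr_realpow[of 2 80] by simp
  also have "(2 powr 80) powr (- (1/2)) = (2::real) powr (- 40)" by (simp only: powr_powr) simp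
  also have "\<dots> \<le> 2 powr (- 4)" by (intro powr_mono) auto
  also have "\<dots> = 1 / 16" by (simp add: powr_minus_divide powr_numeral)
  finally have "real N powr (- (19/20)) + 2 * \<kappa> * d \<le> 1 / 3" using \<kappa>_part by simp
  then have "real (card (input_cube k N)) * real (card (input_cube k N)) * (real N powr (- (19/20)) + 2 * \<kappa> * d)
      \<le> real (card (input_cube k N)) * real (card (input_cube k N)) * (1 / 3)"
    by (intro mult_left_mono) auto
  then show ?thesis using hits_search_le[OF G, of P] unfolding d by linarith
qed

lemma sigma_size_power4: "sigma_size (4 ^ t) = 2 ^ t"
proof -
  have "sqrt (real (4 ^ t)) = of_int (2 ^ t)"
    by (simp add: real_sqrt_power)
  then show ?thesis unfolding sigma_size_def floor_of_int by (simp add: nat_power_eq)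
qed

text \<open>If every protocol in the support were cheaper, each would succeed on at most 1/3 of the
  uniform inputs, whereas averaging over the support forces 2/3. The constant 1/64 squares to the
  1/4096 of the parameter choice.\<close>

lemma cost_lower_bound:
  fixes k :: nat and p :: real
  assumes t: "80 \<le> t" and k: "1 \<le> k" and p: "0 \<le> p" "p \<le> 1"
    and G: "few_conflicts k (2 ^ t) (2 * (1 - p) * real (2 ^ t) + 4 * ln (real k * (real (2 ^ t))\<^sup>2)) (nonadjacent G)"
    and R: "solves_search (4 ^ t) k G R"
  shows "\<exists>P\<in>set_pmf R. real (protocol_cost P) \<ge> 1/64 * lower_bound (4 ^ t) k p"
proof (rule ccontr)
  assume "\<not> (\<exists>P\<in>set_pmf R. real (protocol_cost P) \<ge> 1/64 * lower_bound (4 ^ t) k p)"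
  then have small: "\<And>P. P \<in> set_pmf R \<Longrightarrow> real (protocol_cost P) < 1/64 * lower_bound (4 ^ t) k p"
    by (auto simp: not_le)
  define N :: nat where "N = 2 ^ t"
  have N: "2 ^ 80 \<le> N" unfolding N_def using t by (intro power_increasing) auto
  have N0: "0 < real N" unfolding N_def by simp
  have n: "real (4 ^ t) = (real N)\<^sup>2" unfolding N_def by (simp add: power2_eq_square flip: power_mult_distrib)
  \<comment> \<open>Because \<open>n\<close> is the square of \<open>N\<close>, exponents double:
    0.05 becomes 1/10 and 0.225 becomes 9/20.\<close>
  have n_powr: "real (4 ^ t) powr s = real N powr (2 * s)" for s
    unfolding n using N0 by (simp add: powr_powr flip: powr_numeral)
  have "2 \<le> real N" unfolding N_def using t self_le_power[of "2::real" t] by simp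
  then have "1 * 4 \<le> real k * (real N)\<^sup>2"
    using k power_mono[of 2 "real N" 2] by (intro mult_mono) auto
  then have L: "0 < log 2 (real k * (real N)\<^sup>2)" by simp
  have hits: "hits (\<lambda>x y. search_solution k G x y (run_protocol P x y)) (input_cube k N) (input_cube k N)
    \<le> real (card (input_cube k N)) * real (card (input_cube k N)) * (1/3)" if P: "P \<in> set_pmf R" for P
  proof (rule hits_search_le_third[OF N k _ refl _ refl])
    show "0 \<le> 1 - p" using p by simp
    show "few_conflicts k N (2 * (1 - p) * real N + 4 * ln (real k * (real N)\<^sup>2)) (nonadjacent G)"
      using G unfolding N_def .
    let ?d = "real (protocol_cost P)"
    have "lower_bound (4 ^ t) k p \<le> real N powr (9/20) / log 2 (real k * (real N)\<^sup>2)"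
      unfolding lower_bound_def n_powr unfolding n by auto
    then have "?d \<le> 1/64 * (real N powr (9/20) / log 2 (real k * (real N)\<^sup>2))"
      using small[OF P] by linarith
    then show "?d * log 2 (real k * (real N)\<^sup>2) \<le> real N powr (9/20) / 64"
      using L by (simp add: field_simps)
    show "?d\<^sup>2 * ((1 - p) * real N powr (1/10)) \<le> 1 / 4096"
    proof (cases "p = 1")
      \<comment> \<open>For \<open>p = 1\<close> the lower bound has no first term, and the claim is
        trivial as its factor \<open>1 - p\<close> vanishes.\<close>
      case True
      then show ?thesis by simp
    next
      case False
      define z where "z = real N powr (1/10) * (1 - p)"
      have z: "0 < z" unfolding z_def using False p N0 by simp
      have "lower_bound (4 ^ t) k p \<le> 1 / sqrt z"
        unfolding lower_bound_def n_powr z_def using False by auto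
      then have "?d \<le> 1/64 * (1 / sqrt z)" using small[OF P] by linarith
      then have "?d\<^sup>2 \<le> (1/64 * (1 / sqrt z))\<^sup>2" by (intro power_mono) auto
      also have "\<dots> = 1 / 4096 / z" using z by (simp add: power_divide)
      finally have "?d\<^sup>2 * z \<le> 1 / 4096" using z by (simp add: field_simps)
      then show ?thesis unfolding z_def by (simp add: mult_ac)
    qed
  qed
  have "2 / 3 \<le> (1 / 3 :: real)"
    by (rule solves_search_imp_success[OF R]) (use hits in \<open>simp_all add: sigma_size_power4 N_def\<close>)
  then show False by simp
qed

theorem theorem6p1:
  shows "\<exists>c>0. \<forall>(k::nat \<Rightarrow> nat) (p::nat \<Rightarrow> real).
     (\<forall>n. 0 \<le> p n \<and> p n \<le> 1) \<longrightarrow>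
     ((\<lambda>t. measure_pmf.prob (random_graph (4^t) (k (4^t)) (p (4^t)))
        {G. \<forall>R :: det_protocol pmf. solves_search (4^t) (k (4^t)) G R \<longrightarrow>
              (\<exists>P\<in>set_pmf R. real (protocol_cost P) \<ge>
                   c * lower_bound (4^t) (k (4^t)) (p (4^t)))})
      \<longlonglongrightarrow> 1)"
proof (intro exI[of _ "1/64"] conjI allI impI)
  fix k :: "nat \<Rightarrow> nat" and p :: "nat \<Rightarrow> real"
  assume p: "\<forall>n. 0 \<le> p n \<and> p n \<le> 1"
  define S where "S t = {G. \<forall>R :: det_protocol pmf. solves_search (4^t) (k (4^t)) G R \<longrightarrow>
     (\<exists>P\<in>set_pmf R. real (protocol_cost P) \<ge> 1/64 * lower_bound (4^t) (k (4^t)) (p (4^t)))}" for t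
  \<comment> \<open>The alphabet size is \<open>2 ^ t\<close>, so \<open>80 \<le> t\<close> is the
    requirement \<open>2 ^ 80 \<le> N\<close> of the parameter choice.\<close>
  have lower: "1 - 2 / 2 ^ t \<le> measure_pmf.prob (random_graph (4^t) (k (4^t)) (p (4^t))) (S t)"
    if t: "80 \<le> t" for t
  proof (cases "k (4 ^ t) = 0")
    \<comment> \<open>Without blocks, \<open>log 2 0 = 0\<close> and division by 0 yields 0, so the
      bound is at most 0 and any protocol in the support meets it.\<close>
    case True
    have "lower_bound (4^t) (k (4^t)) (p (4^t)) \<le> 0"
      unfolding lower_bound_def True by (simp add: log_def)
    then have "1/64 * lower_bound (4^t) (k (4^t)) (p (4^t)) \<le> real m" for m
      using of_nat_0_le_iff[of m, where 'a = real] by linarith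
    moreover have "\<exists>P. P \<in> set_pmf R" for R :: "det_protocol pmf"
      using set_pmf_not_empty[of R] by blast
    ultimately have "S t = UNIV" unfolding S_def by blast
    then show ?thesis by simp
  next
    case False
    let ?D = "2 * (1 - p (4^t)) * real (2 ^ t) + 4 * ln (real (k (4^t)) * (real (2 ^ t))\<^sup>2)"
    have k1: "1 \<le> k (4^t)" using False by simp
    have "1 - 2 / real (2 ^ t) \<le> measure_pmf.prob (random_graph (4^t) (k (4^t)) (p (4^t)))
        {G. few_conflicts (k (4^t)) (2 ^ t) ?D (nonadjacent G)}"
      using p k1 by (intro random_graph_few_conflicts sigma_size_power4 refl) auto
    also have "\<dots> \<le> measure_pmf.prob (random_graph (4^t) (k (4^t)) (p (4^t))) (S t)"
      using p cost_lower_bound[OF t k1]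
      unfolding S_def by (intro measure_pmf.finite_measure_mono) auto
    finally show ?thesis by simp
  qed
  have "(\<lambda>t. measure_pmf.prob (random_graph (4^t) (k (4^t)) (p (4^t))) (S t)) \<longlonglongrightarrow> 1"
  proof (rule tendsto_sandwich)
    show "\<forall>\<^sub>F t in sequentially. 1 - 2 / 2 ^ t \<le> measure_pmf.prob (random_graph (4^t) (k (4^t)) (p (4^t))) (S t)"
      using eventually_ge_at_top[of 80] by eventually_elim (rule lower)
    show "\<forall>\<^sub>F t in sequentially. measure_pmf.prob (random_graph (4^t) (k (4^t)) (p (4^t))) (S t) \<le> 1"
      by simp
    have "(\<lambda>t. 1 - 2 * (1 / 2) ^ t) \<longlonglongrightarrow> 1 - 2 * (0::real)"
      by (intro tendsto_intros LIMSEQ_realpow_zero) auto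
    then show "(\<lambda>t. 1 - 2 / 2 ^ t :: real) \<longlonglongrightarrow> 1" by (simp add: power_divide)
  qed simp
  then show "(\<lambda>t. measure_pmf.prob (random_graph (4^t) (k (4^t)) (p (4^t)))
        {G. \<forall>R :: det_protocol pmf. solves_search (4^t) (k (4^t)) G R \<longrightarrow>
              (\<exists>P\<in>set_pmf R. real (protocol_cost P) \<ge>
                   1/64 * lower_bound (4^t) (k (4^t)) (p (4^t)))}) \<longlonglongrightarrow> 1"
    unfolding S_def .
qed simp

end
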